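(* Let $P_d\in\mathbb R^n$ be constant and let $\Omega$ be the set of steady states of the closed-loop system $$\begin{bmatrix}\dot x_p\\ \dot\vartheta\end{bmatrix}=\begin{bmatrix}J-R-R_K&G^T\\-G&-L_c\end{bmatrix}\nabla H(x_p,\vartheta)-\begin{bmatrix}g\\0\end{bmatrix}P_d,\qquad H(x_p,\vartheta)=H_p(x_p)+\tfrac12\vartheta^TT^{-1}\vartheta,$$ with all data as defined in the context. Suppose that for all $i\in\mathcal V$ $$4(X_{di}'-X_{di}'')T_{di}'-(X_{di}-X_{di}')T_{di}''>0,\qquad 4(X_{qi}'-X_{qi}'')T_{qi}'-(X_{qi}-X_{qi}')T_{qi}''>0,$$ and that there exists $\bar x\in\Omega$ such that the Hessian $\nabla^2H(\bar x)$ is positive definite. Then the trajectories $x=(x_p,\vartheta)$ of the closed-loop system initialized in a sufficiently small neighborhood around $\bar x$ converge to the set of optimal points $\Omega$ (i.e. their distance to $\Omega$ tends to $0$ as $t\to\infty$).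
   Context: **Network.** $\mathcal G=(\mathcal V,\mathcal E)$ is a connected undirected graph with $\mathcal V=\{1,\dots,n\}$ and $m$ edges. The ends of each edge are arbitrarily labeled $+$ and $-$, and $D\in\mathbb R^{n\times m}$ is the incidence matrix ($D_{il}=+1$ if $i$ is the positive end of $l$, $-1$ if $i$ is the negative end of $l$, $0$ otherwise). Each edge between $i$ and $k$ has a susceptance $B_{ik}=B_{ki}<0$. **Parameters.** For every $i\in\mathcal V$: $M_i>0$; time constants $T_{di}',T_{qi}',T_{di}'',T_{qi}''>0$; reactances with $X_{di}>X_{di}'>X_{di}''>0$, $X_{qi}>X_{qi}'>X_{qi}''>0$ and $X_{di}''=X_{qi}''$; the excitation voltage $E_{fi}\in\mathbb R$ is constant. **State.** $x_p=(p,\eta,E_q',E_d',E_q'',E_d'')$ with $p\in\mathbb R^n$, $\eta\in\mathbb R^m$ ($\eta=D^T\delta$ are the rotor angle differences), $E_q',E_d',E_q'',E_d''\in\mathbb R^n$; $\vartheta\in\mathbb R^n$. The frequency deviation is $\omega_i=M_i^{-1}p_i$. **Hamiltonian of the network.** $H_p=\sum_{i\in\mathcal V}(H_{edi}+H_{eqi}+H_{mi})+\sum_{l\in\mathcal E}H_l$, where $$H_{edi}=\tfrac12\Big(\tfrac{(E_{qi}'-E_{fi})^2}{X_{di}-X_{di}'}+\tfrac{(E_{qi}'-E_{qi}'')^2}{X_{di}'-X_{di}''}\Big),\quad H_{eqi}=\tfrac12\Big(\tfrac{(E_{di}')^2}{X_{qi}-X_{qi}'}+\tfrac{(E_{di}'-E_{di}'')^2}{X_{qi}'-X_{qi}''}\Big),\quad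 H_{mi}=\tfrac12M_i^{-1}p_i^2,$$ and for the edge $l$ with positive end $i$ and negative end $k$, $$H_l=-\tfrac12B_{ik}\Big(2(E_{di}''E_{qk}''-E_{dk}''E_{qi}'')\sin\eta_l-2(E_{di}''E_{dk}''+E_{qi}''E_{qk}'')\cos\eta_l+E_{di}''^2+E_{dk}''^2+E_{qi}''^2+E_{qk}''^2\Big).$$ **Matrices.** $\hat X_d=\mathrm{diag}(X_{di}-X_{di}')$, $\hat X_d'=\mathrm{diag}(X_{di}'-X_{di}'')$, $\hat X_q=\mathrm{diag}(X_{qi}-X_{qi}')$, $\hat X_q'=\mathrm{diag}(X_{qi}'-X_{qi}'')$, $T_d'=\mathrm{diag}(T_{di}')$, and similarly $T_q',T_d'',T_q''$. In block form corresponding to $(p,\eta,E_q',E_d',E_q'',E_d'')$, $$J-R=\begin{bmatrix}0&-D&0&0&0&0\\ D^T&0&0&0&0&0\\ 0&0&-(T_d')^{-1}\hat X_d&0&-(T_d')^{-1}\hat X_d&0\\ 0&0&0&-(T_q')^{-1}\hat X_q&0&-(T_q')^{-1}\hat X_q\\ 0&0&0&0&-(T_d'')^{-1}\hat X_d'&0\\ 0&0&0&0&0&-(T_q'')^{-1}\hat X_q'\end{bmatrix}$$ ($J$ skew-symmetric, $R$ symmetric), $g=\begin{bmatrix}I&0&0&0&0&0\end{bmatrix}^T$, $G=\begin{bmatrix}Q^{-1}&0&0&0&0&0\end{bmatrix}$, $R_K=\mathrm{blockdiag}(K,0,0,0,0,0)$. **Controller.** $Q=Q^T>0$ is an $n\times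 n$ cost matrix; $T=\mathrm{diag}(T_i)>0$ and $K=\mathrm{diag}(k_i)>0$ are controller parameters; $L_c$ is the Laplacian matrix of a connected undirected (positively) weighted communication graph on $\mathcal V$. The closed-loop system is the interconnection of the network $\dot x_p=(J-R)\nabla H_p+g(P_m-P_d)$ with the controller $T\dot\theta=-L_c\theta-Q^{-1}\omega$, $P_m=Q^{-1}\theta-K\omega$, where $\vartheta=T\theta$. **Optimal points.** Points of $\Omega$ are called optimal because at each of them $\omega=0$ and the power injection $P_m=Q^{-1}\theta-K\omega$ satisfies the optimality conditions $P_m=Q^{-1}\mathbf 1\lambda^*$, $\lambda^*=\frac{\mathbf 1^TP_d}{\mathbf 1^TQ^{-1}\mathbf 1}$, of the problem $\min_{P_m}\tfrac12P_m^TQP_m$ subject to $\mathbf 1^TP_m=\mathbf 1^TP_d$, where $\mathbf 1$ is the all-ones vector. *)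

theory Defs
  imports "HOL-Analysis.Analysis"
begin

text \<open>The gradient with respect to the inner product of the space.\<close>

definition gradient :: "('a::real_inner \<Rightarrow> real) \<Rightarrow> 'a \<Rightarrow> 'a" where
  "gradient f x = (THE d. GDERIV f x :> d)"

definition hessian :: "('a::real_inner \<Rightarrow> real) \<Rightarrow> 'a \<Rightarrow> 'a \<Rightarrow> 'a" where
  "hessian f x = frechet_derivative (gradient f) (at x)"

definition positive_definite_on :: "'a::real_inner set \<Rightarrow> ('a \<Rightarrow> 'a) \<Rightarrow> bool" where
  "positive_definite_on S A \<longleftrightarrow> (\<forall>v\<in>S. v \<noteq> 0 \<longrightarrow> v \<bullet> A v > 0)"

definition diagm :: "('n::finite \<Rightarrow> real) \<Rightarrow> real^'n^'n" where
  "diagm d = (\<chi> i j. if i = j then d i else 0)"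

definition laplacian :: "('n::finite \<Rightarrow> 'n \<Rightarrow> real) \<Rightarrow> real^'n^'n" where
  "laplacian w = (\<chi> i j. if i = j then (\<Sum>k\<in>UNIV - {i}. w i k) else - w i j)"

definition connected_rel :: "('n \<times> 'n) set \<Rightarrow> bool" where
  "connected_rel E \<longleftrightarrow> (\<forall>i k. (i, k) \<in> (E \<union> E\<inverse>)\<^sup>*)"

text \<open>
  Nodes are the elements of the finite type \<open>'n\<close>. An edge with positive end \<open>i\<close> and
  negative end \<open>k\<close> is the pair \<open>(i, k)\<close>, so \<open>edges\<close> is an orientation of the underlying
  undirected graph; that graph is simple iff \<open>edges\<close> is asymmetric (see \<open>network_ok\<close>).
\<close>

record 'n network =
  edges :: "('n \<times> 'n) set"
  susceptance :: "'n \<Rightarrow> 'n \<Rightarrow> real"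
  inertia :: "'n \<Rightarrow> real"
  Td' :: "'n \<Rightarrow> real"
  Tq' :: "'n \<Rightarrow> real"
  Td'' :: "'n \<Rightarrow> real"
  Tq'' :: "'n \<Rightarrow> real"
  Xd :: "'n \<Rightarrow> real"
  Xd' :: "'n \<Rightarrow> real"
  Xd'' :: "'n \<Rightarrow> real"
  Xq :: "'n \<Rightarrow> real"
  Xq' :: "'n \<Rightarrow> real"
  Xq'' :: "'n \<Rightarrow> real"
  excitation :: "'n \<Rightarrow> real"

definition network_ok :: "'n network \<Rightarrow> bool" where
  "network_ok N \<longleftrightarrow>
     asym (edges N) \<and> connected_rel (edges N) \<and>
     (\<forall>(i, k)\<in>edges N. susceptance N i k = susceptance N k i \<and> susceptance N i k < 0) \<and>
     (\<forall>i. inertia N i > 0 \<and>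
          Td' N i > 0 \<and> Tq' N i > 0 \<and> Td'' N i > 0 \<and> Tq'' N i > 0 \<and>
          Xd N i > Xd' N i \<and> Xd' N i > Xd'' N i \<and> Xd'' N i > 0 \<and>
          Xq N i > Xq' N i \<and> Xq' N i > Xq'' N i \<and> Xq'' N i > 0 \<and>
          Xd'' N i = Xq'' N i)"

text \<open>
  Network states \<open>(p, \<eta>, Eq', Ed', Eq'', Ed'')\<close> and closed-loop states \<open>(x\<^sub>p, \<vartheta>)\<close>.
  The number of edges \<open>m\<close> may be \<open>0\<close> (a single node), which rules out a type of edges as
  the index type of \<open>\<eta>\<close>. Instead \<open>\<eta>\<close> is indexed by all pairs of nodes and vanishes off the
  edges: the actual state space, a copy of \<open>\<real>\<^sup>m\<close> in the \<open>\<eta>\<close> component, is the subspace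
  \<open>state_space N\<close>. The Hamiltonian below does not depend on the components of \<open>\<eta>\<close> off the
  edges, so its gradient and Hessian take values in this subspace.
\<close>

type_synonym 'n net_state =
  "(real^'n) \<times> (real^('n \<times> 'n)) \<times> (real^'n) \<times> (real^'n) \<times> (real^'n) \<times> (real^'n)"

type_synonym 'n state = "'n net_state \<times> (real^'n)"

definition state_space :: "'n::finite network \<Rightarrow> 'n state set" where
  "state_space N = {((p, \<eta>, Eq', Ed', Eq'', Ed''), \<theta>) | p \<eta> Eq' Ed' Eq'' Ed'' \<theta>.
     \<forall>l. l \<notin> edges N \<longrightarrow> \<eta> $ l = 0}"

definition incidence :: "'n::finite network \<Rightarrow> real^('n \<times> 'n)^'n" where
  "incidence N = (\<chi> i l. if l \<in> edges N \<and> i = fst l then 1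
                         else if l \<in> edges N \<and> i = snd l then - 1 else 0)"

definition H_d :: "'n::finite network \<Rightarrow> real^'n \<Rightarrow> real^'n \<Rightarrow> 'n \<Rightarrow> real" where
  "H_d N Eq' Eq'' i = 1/2 * ((Eq' $ i - excitation N i)\<^sup>2 / (Xd N i - Xd' N i)
                           + (Eq' $ i - Eq'' $ i)\<^sup>2 / (Xd' N i - Xd'' N i))"

definition H_q :: "'n::finite network \<Rightarrow> real^'n \<Rightarrow> real^'n \<Rightarrow> 'n \<Rightarrow> real" where
  "H_q N Ed' Ed'' i = 1/2 * ((Ed' $ i)\<^sup>2 / (Xq N i - Xq' N i)
                           + (Ed' $ i - Ed'' $ i)\<^sup>2 / (Xq' N i - Xq'' N i))"

definition H_m :: "'n::finite network \<Rightarrow> real^'n \<Rightarrow> 'n \<Rightarrow> real" where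
  "H_m N p i = 1/2 * inverse (inertia N i) * (p $ i)\<^sup>2"

definition H_edge ::
  "'n::finite network \<Rightarrow> real^('n \<times> 'n) \<Rightarrow> real^'n \<Rightarrow> real^'n \<Rightarrow> 'n \<times> 'n \<Rightarrow> real" where
  "H_edge N \<eta> Eq'' Ed'' = (\<lambda>(i, k).
     - 1/2 * susceptance N i k *
       (2 * (Ed'' $ i * Eq'' $ k - Ed'' $ k * Eq'' $ i) * sin (\<eta> $ (i, k))
        - 2 * (Ed'' $ i * Ed'' $ k + Eq'' $ i * Eq'' $ k) * cos (\<eta> $ (i, k))
        + (Ed'' $ i)\<^sup>2 + (Ed'' $ k)\<^sup>2 + (Eq'' $ i)\<^sup>2 + (Eq'' $ k)\<^sup>2))"

definition H_net :: "'n::finite network \<Rightarrow> 'n net_state \<Rightarrow> real" where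
  "H_net N = (\<lambda>(p, \<eta>, Eq', Ed', Eq'', Ed'').
     (\<Sum>i\<in>UNIV. H_d N Eq' Eq'' i + H_q N Ed' Ed'' i + H_m N p i)
     + (\<Sum>l\<in>edges N. H_edge N \<eta> Eq'' Ed'' l))"

text \<open>The block matrix \<open>J - R\<close>, applied to a block vector.\<close>

definition J_minus_R :: "'n::finite network \<Rightarrow> 'n net_state \<Rightarrow> 'n net_state" where
  "J_minus_R N = (\<lambda>(p, \<eta>, Eq', Ed', Eq'', Ed'').
     let D = incidence N;
         A\<^sub>d = matrix_inv (diagm (Td' N)) ** diagm (\<lambda>i. Xd N i - Xd' N i);
         A\<^sub>q = matrix_inv (diagm (Tq' N)) ** diagm (\<lambda>i. Xq N i - Xq' N i);
         A\<^sub>d' = matrix_inv (diagm (Td'' N)) ** diagm (\<lambda>i. Xd' N i - Xd'' N i);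
         A\<^sub>q' = matrix_inv (diagm (Tq'' N)) ** diagm (\<lambda>i. Xq' N i - Xq'' N i)
     in (- (D *v \<eta>),
         transpose D *v p,
         - (A\<^sub>d *v Eq') - A\<^sub>d *v Eq'',
         - (A\<^sub>q *v Ed') - A\<^sub>q *v Ed'',
         - (A\<^sub>d' *v Eq''),
         - (A\<^sub>q' *v Ed'')))"

text \<open>
  The communication graph has an edge between \<open>i\<close> and \<open>k\<close> iff \<open>comm_weight C i k > 0\<close>.
\<close>

record 'n controller =
  cost :: "real^'n^'n"
  time_const :: "'n \<Rightarrow> real"
  gain :: "'n \<Rightarrow> real"
  comm_weight :: "'n \<Rightarrow> 'n \<Rightarrow> real"

definition controller_ok :: "'n::finite controller \<Rightarrow> bool" where
  "controller_ok C \<longleftrightarrow>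
     transpose (cost C) = cost C \<and> positive_definite_on UNIV ((*v) (cost C)) \<and>
     (\<forall>i. time_const C i > 0 \<and> gain C i > 0) \<and>
     (\<forall>i k. comm_weight C i k = comm_weight C k i \<and> comm_weight C i k \<ge> 0) \<and>
     (\<forall>i. comm_weight C i i = 0) \<and>
     connected_rel {(i, k). comm_weight C i k > 0}"

definition R_K :: "'n::finite controller \<Rightarrow> 'n net_state \<Rightarrow> 'n net_state" where
  "R_K C = (\<lambda>(p, _). (diagm (gain C) *v p, 0, 0, 0, 0, 0))"

definition g_in :: "real^'n::finite \<Rightarrow> 'n net_state" where
  "g_in u = (u, 0, 0, 0, 0, 0)"

definition G_out :: "'n::finite controller \<Rightarrow> 'n net_state \<Rightarrow> real^'n" where
  "G_out C = (\<lambda>(p, _). matrix_inv (cost C) *v p)"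

text \<open>The transpose of \<open>G_out C\<close>.\<close>

definition G_out_transpose :: "'n::finite controller \<Rightarrow> real^'n \<Rightarrow> 'n net_state" where
  "G_out_transpose C u = (transpose (matrix_inv (cost C)) *v u, 0, 0, 0, 0, 0)"

definition H_total :: "'n::finite network \<Rightarrow> 'n controller \<Rightarrow> 'n state \<Rightarrow> real" where
  "H_total N C = (\<lambda>(x\<^sub>p, \<theta>).
     H_net N x\<^sub>p + 1/2 * (\<theta> \<bullet> (matrix_inv (diagm (time_const C)) *v \<theta>)))"

definition closed_loop ::
  "'n::finite network \<Rightarrow> 'n controller \<Rightarrow> real^'n \<Rightarrow> 'n state \<Rightarrow> 'n state" where
  "closed_loop N C Pd x =
     (let (u, v) = gradient (H_total N C) x
      in (J_minus_R N u - R_K C u + G_out_transpose C v,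
          - G_out C u - laplacian (comm_weight C) *v v)
         - (g_in Pd, 0))"

definition steady_states ::
  "'n::finite network \<Rightarrow> 'n controller \<Rightarrow> real^'n \<Rightarrow> 'n state set" where
  "steady_states N C Pd = {x \<in> state_space N. closed_loop N C Pd x = 0}"

definition trajectory ::
  "'n::finite network \<Rightarrow> 'n controller \<Rightarrow> real^'n \<Rightarrow> (real \<Rightarrow> 'n state) \<Rightarrow> bool" where
  "trajectory N C Pd x \<longleftrightarrow>
     (\<forall>t\<ge>0. x t \<in> state_space N \<and>
            (x has_vector_derivative closed_loop N C Pd (x t)) (at t within {0..}))"

definition frequency :: "'n::finite network \<Rightarrow> 'n state \<Rightarrow> real^'n" where
  "frequency N = (\<lambda>((p, _), _). \<chi> i. inverse (inertia N i) * p $ i)"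

text \<open>The power injection \<open>Q\<^sup>-\<^sup>1 T\<^sup>-\<^sup>1 \<vartheta> - K \<omega>\<close>, using \<open>\<vartheta> = T \<theta>\<close>.\<close>

definition power_injection ::
  "'n::finite network \<Rightarrow> 'n controller \<Rightarrow> 'n state \<Rightarrow> real^'n" where
  "power_injection N C x =
     matrix_inv (cost C) *v (matrix_inv (diagm (time_const C)) *v snd x)
     - diagm (gain C) *v frequency N x"

definition optimal_points ::
  "'n::finite network \<Rightarrow> 'n controller \<Rightarrow> real^'n \<Rightarrow> 'n state set" where
  "optimal_points N C Pd =
     {x \<in> state_space N. frequency N x = 0 \<and>
        (let lam = (vec 1 \<bullet> Pd) / (vec 1 \<bullet> (matrix_inv (cost C) *v vec 1))
         in power_injection N C x = matrix_inv (cost C) *v (lam *\<^sub>R vec 1))}"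

end

theory Submission
  imports Defs
begin

text \<open>
  Write \<open>G = \<nabla>H\<close> and let \<open>A\<close> be the constant matrix of the closed loop, so that the vector
  field is \<open>F x = A (G x) - b\<close> with \<open>b = (g P\<^sub>d, 0)\<close>. As \<open>xbar\<close> is a steady state,
  \<open>F x = A (G x - G xbar)\<close>. The shifted Hamiltonian
  \<open>V x = H x - H xbar - G xbar \<bullet> (x - xbar)\<close> has gradient \<open>Z x = G x - G xbar\<close>, hence along
  trajectories \<open>V' = Z \<bullet> A Z = - W\<close>. The skew-symmetric part of \<open>A\<close> drops out, and \<open>W\<close> is a
  nonnegative quadratic form in \<open>Z\<close>: \<open>K\<close> contributes a definite form in the frequencies, the Laplacian a
  semidefinite form in the controller variables, and at each node and each axis the voltages
  contribute a binary quadratic form, whose discriminant is negative exactly under the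
  hypotheses on the time constants and reactances (\<open>inner_structure_map\<close>,
  \<open>dissipation_nonneg_null\<close>).

  Positive definiteness of the Hessian makes \<open>V\<close> grow at least quadratically near \<open>xbar\<close>
  (\<open>positive_definite_hessian_quadratic_growth\<close>). A trajectory that starts close to \<open>xbar\<close>
  therefore never reaches the boundary of a small ball, since it would have to climb over a
  barrier of \<open>V\<close>. The same estimate gives global existence: outside the ball the field is
  replaced by a bounded, globally Lipschitz one, whose solutions exist for all times and never
  see the modification (\<open>lyapunov_stability\<close>).

  For the convergence, LaSalle's invariance principle is replaced by two applications of
  Barbalat's lemma (\<open>lyapunov_barbalat_convergence\<close>). As \<open>V\<close> decreases and is bounded below
  along the trajectory, the first one gives \<open>W \<longlongrightarrow> 0\<close>. Where \<open>W = 0\<close>, the frequency vanishes,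
  and so does every component of \<open>F\<close> except the one of the momenta \<open>p\<close>. Thus \<open>p\<close> converges, and
  the second application gives \<open>p' \<longlongrightarrow> 0\<close>. Every limit point of the trajectory is then a zero of
  \<open>F\<close>, and compactness turns this into convergence of the distance to the steady states.

  The steady states are optimal by linear algebra (\<open>steady_states_optimal\<close>): connectedness of
  the two graphs makes the frequencies and the controller variables constant over the nodes,
  and pairing the equations with the all-ones vector determines the two constants.
\<close>

section \<open>Barbalat's lemma\<close>

text \<open>Over a short window of fixed length \<open>r\<close>, the increment of \<open>g\<close> is \<open>r *\<^sub>R h t\<close> up to an error
  that uniform continuity makes small relative to \<open>r\<close>. Since the increments of \<open>g\<close> tend to
  \<open>0\<close>, so does \<open>h\<close>.\<close>

lemma barbalat:
  fixes g h :: "real \<Rightarrow> 'a::real_normed_vector"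
  assumes deriv: "\<And>t. t \<ge> 0 \<Longrightarrow> (g has_vector_derivative h t) (at t within {0..})"
    and unif: "uniformly_continuous_on {0..} h"
    and lim: "(g \<longlongrightarrow> l) at_top"
  shows "(h \<longlongrightarrow> 0) at_top"
proof (rule tendstoI)
  fix e :: real assume e: "e > 0"
  from unif e obtain d where d: "d > 0"
    and close: "\<And>s t. s \<ge> 0 \<Longrightarrow> t \<ge> 0 \<Longrightarrow> dist s t < d \<Longrightarrow> dist (h s) (h t) < e / 2"
    unfolding uniformly_continuous_on_def by (metis atLeast_iff half_gt_zero)
  define r where "r = d / 2"
  have r: "r > 0" "r < d" using d by (auto simp: r_def)
  have "((\<lambda>t. g (t + r)) \<longlongrightarrow> l) at_top"
    by (rule filterlim_compose[OF lim])
       (auto intro: filterlim_tendsto_add_at_top filterlim_ident tendsto_const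
          simp: add.commute[of _ r])
  from tendsto_diff[OF this lim] have "((\<lambda>t. g (t + r) - g t) \<longlongrightarrow> 0) at_top" by simp
  from tendstoD[OF this, of "r * (e / 2)"] r e
  have "\<forall>\<^sub>F t in at_top. norm (g (t + r) - g t) < r * (e / 2)" by simp
  then show "\<forall>\<^sub>F t in at_top. dist (h t) 0 < e"
    using eventually_ge_at_top[of 0]
  proof eventually_elim
    case (elim t)
    have "norm (g (t + r) - g t - (t + r - t) *\<^sub>R h t) \<le> norm (t + r - t) * (e / 2)"
    proof (rule vector_differentiable_bound_linearization[where S = "{t..t + r}"])
      show "(g has_vector_derivative h s) (at s within {t..t + r})" if "s \<in> {t..t + r}" for s
        using that elim by (intro has_vector_derivative_within_subset[OF deriv]) auto
      show "norm (h s - h t) \<le> e / 2" if "s \<in> {t..t + r}" for s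
        using close[of s t] that elim r by (auto simp: dist_norm)
    qed (use r in \<open>auto simp: closed_segment_eq_real_ivl\<close>)
    moreover have "norm (r *\<^sub>R h t) \<le> norm (g (t + r) - g t) + norm (g (t + r) - g t - r *\<^sub>R h t)"
      by (metis norm_minus_commute norm_triangle_sub)
    ultimately have "r * norm (h t) \<le> norm (g (t + r) - g t) + r * (e / 2)"
      using r by simp
    with elim have "r * norm (h t) < r * e" by simp
    then show ?case using r by simp
  qed
qed

section \<open>Global solutions of bounded Lipschitz vector fields\<close>

lemma indefinite_integral_half_line:
  fixes f :: "real \<Rightarrow> 'a::banach"
  assumes "continuous_on {0..} f" "t \<ge> 0"
  shows "((\<lambda>u. integral {0..u} f) has_vector_derivative f t) (at t within {0..})"
proof -
  have "((\<lambda>u. integral {0..u} f) has_vector_derivative f t) (at t within {0..t+1})"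
    using assms by (intro integral_has_vector_derivative continuous_on_subset[OF assms(1)]) auto
  moreover have "at t within {0..t+1} = at t within {0..}"
    by (rule at_within_nhd[where S = "{..<t+1}"]) auto
  ultimately show ?thesis by simp
qed

text \<open>The Picard operator acts on all of \<open>[0, \<infinity>)\<close> at once if solutions are measured with an
  exponential weight: for \<open>x t = x0 + exp (c * t) *\<^sub>R y t\<close> with \<open>y\<close> bounded, a rate \<open>c\<close> of at
  least twice the Lipschitz constant makes it a contraction by \<open>1/2\<close> in the supremum norm of
  \<open>y\<close>. Boundedness of the field keeps the weighted iterates bounded.\<close>

lemma bounded_lipschitz_field_has_global_solution:
  fixes F :: "'a::banach \<Rightarrow> 'a"
  assumes lip: "L-lipschitz_on UNIV F" and bdd: "bounded (range F)"
  obtains x where "x 0 = x0"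
    "\<And>t. t \<ge> 0 \<Longrightarrow> (x has_vector_derivative F (x t)) (at t within {0..})"
proof -
  obtain B where B: "\<And>x. norm (F x) \<le> B" using bdd by (auto simp: bounded_iff)
  have B0: "B \<ge> 0" using B[of 0] norm_ge_zero order_trans by blast
  have L0: "L \<ge> 0" using lip by (rule lipschitz_on_nonneg)
  \<comment> \<open>The summand 1 ensures t \<le> exp (c * t), which bounds the weighted iterates even if L = 0.\<close>
  define c where "c = 2 * L + 1"
  have c: "c \<ge> 1" "L \<le> c / 2" using L0 by (auto simp: c_def)
  define v where "v y s = F (x0 + exp (c * s) *\<^sub>R y s)" for y s
  define I where "I y t = integral {0..t} (v y)" for y t
  \<comment> \<open>Time is clamped at 0 so that the weighted functions live on the whole real line, where
    bounded continuous functions form a complete space.\<close>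
  define P where "P y t = exp (- (c * max 0 t)) *\<^sub>R I y (max 0 t)" for y t
  have v_cont: "continuous_on S (v (apply_bcontfun y))" for S and y :: "real \<Rightarrow>\<^sub>C 'a"
    unfolding v_def
    by (rule continuous_on_compose2[OF lipschitz_on_continuous_on[OF lip]])
       (auto intro!: continuous_intros)
  have v_int: "v (apply_bcontfun y) integrable_on {0..t}" for t and y :: "real \<Rightarrow>\<^sub>C 'a"
    by (intro integrable_continuous_real v_cont)
  have I_deriv: "(I (apply_bcontfun y) has_vector_derivative v y t) (at t within {0..})"
    if "t \<ge> 0" for t and y :: "real \<Rightarrow>\<^sub>C 'a"
    unfolding I_def using that by (intro indefinite_integral_half_line v_cont)
  have I_cont: "continuous_on {0..} (I (apply_bcontfun y))" for y :: "real \<Rightarrow>\<^sub>C 'a"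
    by (rule continuous_on_vector_derivative[OF I_deriv]) simp
  have P_cont: "continuous_on UNIV (P (apply_bcontfun y))" for y :: "real \<Rightarrow>\<^sub>C 'a"
    unfolding P_def
    by (intro continuous_intros continuous_on_compose2[OF I_cont]) auto
  have P_bound: "norm (P (apply_bcontfun y) t) \<le> B" for t and y :: "real \<Rightarrow>\<^sub>C 'a"
  proof -
    define s where "s = max 0 t"
    have s: "s \<ge> 0" by (simp add: s_def)
    have "norm (I (apply_bcontfun y) s) \<le> integral {0..s} (\<lambda>_. B)"
      unfolding I_def by (intro integral_norm_bound_integral v_int) (auto simp: v_def B)
    also have "\<dots> = s * B" using s by simp
    finally have "norm (I (apply_bcontfun y) s) \<le> s * B" .
    moreover have "s \<le> exp (c * s)"
    proof -
      have "s \<le> c * s" using c s by (simp add: mult_right_le_one_le mult_le_cancel_right1)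
      also have "\<dots> \<le> exp (c * s)" using exp_ge_add_one_self[of "c * s"] by linarith
      finally show ?thesis .
    qed
    ultimately have "norm (I (apply_bcontfun y) s) \<le> exp (c * s) * B"
      using B0 by (meson mult_right_mono order_trans)
    then show ?thesis
      unfolding P_def s_def[symmetric] by (simp add: exp_minus field_simps)
  qed
  have P_bcontfun: "P (apply_bcontfun y) \<in> bcontfun" for y :: "real \<Rightarrow>\<^sub>C 'a"
    using P_cont P_bound by (auto simp: bcontfun_def bounded_iff)
  define \<Phi> where "\<Phi> y = Bcontfun (P (apply_bcontfun y))" for y :: "real \<Rightarrow>\<^sub>C 'a"
  have \<Phi>_apply: "apply_bcontfun (\<Phi> y) = P (apply_bcontfun y)" for y
    unfolding \<Phi>_def by (rule Bcontfun_inverse[OF P_bcontfun])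
  have "dist (\<Phi> y) (\<Phi> z) \<le> 1/2 * dist y z" for y z
  proof (rule dist_bound)
    fix t :: real
    define s where "s = max 0 t"
    have s: "s \<ge> 0" by (simp add: s_def)
    define d where "d = dist y z"
    have "norm (I y s - I z s) = norm (integral {0..s} (\<lambda>u. v y u - v z u))"
      unfolding I_def by (simp add: integral_diff v_int)
    also have "\<dots> \<le> integral {0..s} (\<lambda>u. L * d * exp (c * u))"
    proof (rule integral_norm_bound_integral)
      show "(\<lambda>u. v y u - v z u) integrable_on {0..s}" by (intro integrable_diff v_int)
      show "(\<lambda>u. L * d * exp (c * u)) integrable_on {0..s}"
        by (intro integrable_continuous_real continuous_intros)
      fix u
      have "norm (v y u - v z u) \<le> L * dist (x0 + exp (c * u) *\<^sub>R y u) (x0 + exp (c * u) *\<^sub>R z u)"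
        unfolding v_def dist_norm[symmetric] by (rule lipschitz_onD[OF lip]) auto
      also have "\<dots> = L * (exp (c * u) * dist (y u) (z u))"
        by (simp add: dist_norm flip: scaleR_diff_right)
      also have "\<dots> \<le> L * (exp (c * u) * d)"
        unfolding d_def by (intro mult_left_mono dist_bounded L0) auto
      finally show "norm (v y u - v z u) \<le> L * d * exp (c * u)" by (simp add: mult_ac)
    qed
    also have "\<dots> = L * d * (exp (c * s) / c) - L * d * (exp (c * 0) / c)"
      by (rule integral_unique[OF fundamental_theorem_of_calculus])
         (use s c in \<open>auto intro!: derivative_eq_intros
            simp: has_real_derivative_iff_has_vector_derivative[symmetric]\<close>)
    also have "\<dots> \<le> L * d * (exp (c * s) / c)"
      using L0 c by (simp add: d_def)
    finally have "norm (I y s - I z s) \<le> L * d * (exp (c * s) / c)" .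
    then have "exp (- (c * s)) * norm (I y s - I z s) \<le> exp (- (c * s)) * (L * d * (exp (c * s) / c))"
      by (intro mult_left_mono) auto
    also have "\<dots> = L / c * d" by (simp add: exp_minus field_simps)
    also have "\<dots> \<le> 1/2 * d"
      using c by (intro mult_right_mono) (auto simp: d_def field_simps)
    finally show "dist (\<Phi> y t) (\<Phi> z t) \<le> 1/2 * dist y z"
      unfolding \<Phi>_apply P_def s_def[symmetric] d_def
      by (simp add: dist_norm flip: scaleR_diff_right)
  qed
  with banach_fix_type[of "1/2" \<Phi>] obtain y where y: "\<Phi> y = y" by auto
  define x where "x t = x0 + I y t" for t
  have x_eq: "x t = x0 + exp (c * t) *\<^sub>R y t" if "t \<ge> 0" for t
  proof -
    have "y t = exp (- (c * t)) *\<^sub>R I y t"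
      using \<Phi>_apply[of y] that unfolding y by (simp add: P_def fun_eq_iff)
    then show ?thesis by (simp add: x_def exp_minus)
  qed
  show ?thesis
  proof (rule that)
    show "x 0 = x0" by (simp add: x_def I_def)
    show "(x has_vector_derivative F (x t)) (at t within {0..})" if t: "t \<ge> 0" for t
    proof -
      have "(x has_vector_derivative 0 + v y t) (at t within {0..})"
        unfolding x_def[abs_def] by (intro has_vector_derivative_add I_deriv t has_vector_derivative_const)
      then show ?thesis by (simp add: v_def x_eq[OF t])
    qed
  qed
qed

section \<open>Trajectories along which a Lyapunov function decreases\<close>

text \<open>Pairing the solution with a vector orthogonal to \<open>S\<close> gives a function with derivative \<open>0\<close>.\<close>

lemma solution_stays_in_subspace:
  fixes x :: "real \<Rightarrow> 'a::euclidean_space"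
  assumes S: "subspace S" and F: "\<And>y. F y \<in> S" and x0: "x 0 \<in> S"
    and x: "\<And>t. t \<ge> 0 \<Longrightarrow> (x has_vector_derivative F (x t)) (at t within {0..})"
    and t: "t \<ge> 0"
  shows "x t \<in> S"
proof -
  have "x t \<bullet> v = 0" if v: "\<And>y. y \<in> S \<Longrightarrow> y \<bullet> v = 0" for v
  proof -
    have "((\<lambda>s. x s \<bullet> v) has_derivative (\<lambda>h. 0)) (at s within {0..})" if "s \<in> {0..}" for s
    proof -
      have "((\<lambda>s. x s \<bullet> v) has_derivative (\<lambda>h. (h *\<^sub>R F (x s)) \<bullet> v)) (at s within {0..})"
        using x[of s] that
        by (intro has_derivative_inner_left) (simp add: has_vector_derivative_def)
      then show ?thesis using v[OF F] by simp
    qed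
    from has_derivative_zero_constant[OF _ this] obtain c where "\<forall>s\<in>{0..}. x s \<bullet> v = c"
      by (auto simp: convex_real_interval)
    then show ?thesis using v[OF x0] t by fastforce
  qed
  then have "x t \<in> (S\<^sup>\<bottom>)\<^sup>\<bottom>"
    by (auto simp: orthogonal_comp_def orthogonal_def inner_commute)
  then show ?thesis using orthogonal_comp_self[OF S] by simp
qed

text \<open>At the first time at which the distance reaches \<open>r\<close>, the trajectory has so far been inside
  the ball, so that \<open>V\<close> has not increased; but on the sphere \<open>V\<close> exceeds its initial value. The
  decrease of \<open>V\<close> is asked for only inside the ball, because this is where a truncated vector
  field agrees with the original one.\<close>

lemma potential_barrier_confines:
  fixes x :: "real \<Rightarrow> 'a::metric_space" and V :: "'a \<Rightarrow> real"
  assumes cont: "continuous_on {0..} x" and start: "dist z (x 0) < r"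
    and decr: "\<And>T. \<lbrakk>T \<ge> 0; \<And>s. \<lbrakk>0 \<le> s; s \<le> T\<rbrakk> \<Longrightarrow> dist z (x s) \<le> r\<rbrakk> \<Longrightarrow> V (x T) \<le> V (x 0)"
    and barrier: "\<And>T. \<lbrakk>T \<ge> 0; dist z (x T) = r\<rbrakk> \<Longrightarrow> V (x 0) < V (x T)"
    and t: "t \<ge> 0"
  shows "dist z (x t) < r"
proof (rule ccontr)
  assume out: "\<not> dist z (x t) < r"
  define d where "d s = dist z (x s)" for s
  have d_cont: "continuous_on A d" if "A \<subseteq> {0..}" for A
    unfolding d_def by (intro continuous_intros continuous_on_subset[OF cont that])
  have "closed {s \<in> {0..t}. r \<le> d s}"
    by (intro continuous_on_closed_Collect_le d_cont continuous_on_const) auto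
  from compact_Int_closed[OF compact_Icc[of 0 t] this]
  have "compact {s \<in> {0..t}. r \<le> d s}"
    by (rule back_subst[where P = compact]) auto
  moreover have "t \<in> {s \<in> {0..t}. r \<le> d s}" using out t by (auto simp: d_def)
  ultimately obtain T where T: "0 \<le> T" "T \<le> t" "r \<le> d T"
    and first: "\<And>s. 0 \<le> s \<Longrightarrow> s \<le> t \<Longrightarrow> r \<le> d s \<Longrightarrow> T \<le> s"
    using compact_attains_inf[of "{s \<in> {0..t}. r \<le> d s}"] by auto
  have "\<exists>s\<ge>0. s \<le> T \<and> d s = r"
    by (rule IVT'[of d]) (use start T d_cont in \<open>auto simp: d_def[of 0]\<close>)
  then have dT: "d T = r" using first T by (metis antisym order.refl order_trans)
  have "d s \<le> r" if "0 \<le> s" "s \<le> T" for s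
    using first[of s] that T dT by force
  then have "V (x T) \<le> V (x 0)" using decr[of T] T by (simp add: d_def)
  with barrier[of T] T dT show False by (simp add: d_def)
qed

text \<open>On the compact set of points of \<open>K\<close> where \<open>\<bar>h\<bar> \<ge> e\<close>, the function \<open>\<bar>g\<bar>\<close> has a positive lower
  bound. This replaces the extraction of convergent subsequences of a trajectory.\<close>

lemma tendsto_zero_on_compact:
  fixes x :: "real \<Rightarrow> 'a::metric_space" and g h :: "'a \<Rightarrow> real"
  assumes K: "compact K" and x: "\<And>t. t \<ge> 0 \<Longrightarrow> x t \<in> K"
    and g: "continuous_on K g" and h: "continuous_on K h"
    and zeros: "\<And>y. y \<in> K \<Longrightarrow> g y = 0 \<Longrightarrow> h y = 0"
    and lim: "((\<lambda>t. g (x t)) \<longlongrightarrow> 0) at_top"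
  shows "((\<lambda>t. h (x t)) \<longlongrightarrow> 0) at_top"
proof (rule tendstoI)
  fix e :: real assume e: "e > 0"
  define A where "A = {y \<in> K. e \<le> \<bar>h y\<bar>}"
  have "closed A"
    using continuous_closed_preimage[OF continuous_on_rabs[OF h] compact_imp_closed[OF K], of "{e..}"]
    by (simp add: A_def vimage_def Int_def)
  then have A: "compact A" using K compact_Int_closed[of K A] by (simp add: A_def Int_def cong: conj_cong)
  have gA: "continuous_on A (\<lambda>y. \<bar>g y\<bar>)"
    by (rule continuous_on_subset[OF continuous_on_rabs[OF g]]) (auto simp: A_def)
  have "\<exists>m>0. \<forall>y\<in>A. m \<le> \<bar>g y\<bar>"
  proof (cases "A = {}")
    case False
    from continuous_attains_inf[OF A False gA] obtain y
      where y: "y \<in> A" "\<forall>z\<in>A. \<bar>g y\<bar> \<le> \<bar>g z\<bar>" by auto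
    have "g y \<noteq> 0" using zeros[of y] y(1) e by (auto simp: A_def)
    with y show ?thesis by (intro exI[of _ "\<bar>g y\<bar>"]) auto
  qed (auto intro: exI[of _ 1])
  then obtain m where m: "m > 0" "\<And>y. y \<in> A \<Longrightarrow> m \<le> \<bar>g y\<bar>" by auto
  from tendstoD[OF lim m(1)] eventually_ge_at_top[of 0]
  show "\<forall>\<^sub>F t in at_top. dist (h (x t)) 0 < e"
  proof eventually_elim
    case (elim t)
    then have "x t \<notin> A" using m(2)[of "x t"] by auto
    then show ?case using x elim by (auto simp: A_def)
  qed
qed

lemma gradient_chain:
  assumes "GDERIV V (x t) :> Z" "(x has_vector_derivative v) (at t within T)"
  shows "((\<lambda>s. V (x s)) has_vector_derivative (Z \<bullet> v)) (at t within T)"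
proof -
  have "((\<lambda>s. V (x s)) has_derivative (\<lambda>h. (h *\<^sub>R v) \<bullet> Z)) (at t within T)"
    by (rule has_derivative_compose[where g = V])
       (use assms in \<open>auto simp: has_vector_derivative_def gderiv_def\<close>)
  then show ?thesis by (simp add: has_vector_derivative_def inner_commute)
qed

lemma nonincreasing_along:
  fixes f :: "real \<Rightarrow> real"
  assumes der: "\<And>t. \<lbrakk>a \<le> t; t \<le> b\<rbrakk> \<Longrightarrow> (f has_vector_derivative f' t) (at t within {0..})"
    and neg: "\<And>t. \<lbrakk>a \<le> t; t \<le> b\<rbrakk> \<Longrightarrow> f' t \<le> 0" and "0 \<le> a" "a \<le> b"
  shows "f b \<le> f a"
proof -
  have "((\<lambda>t. - f' t) has_integral - (f b - f a)) {a..b}"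
    using assms
    by (intro has_integral_neg fundamental_theorem_of_calculus has_vector_derivative_within_subset[OF der]) auto
  then have "0 \<le> - (f b - f a)"
    by (rule has_integral_nonneg) (use neg in auto)
  then show ?thesis by simp
qed

text \<open>A substitute for LaSalle's principle in which no \<open>\<omega>\<close>-limit sets appear. Barbalat's lemma
  gives \<open>W \<longlongrightarrow> 0\<close> along \<open>x\<close>. The linear map \<open>P\<close> selects coordinates that are frozen on the zero
  set of \<open>W\<close>; they converge, so Barbalat's lemma applies a second time and their velocities
  \<open>P (F x)\<close> tend to \<open>0\<close>. The set \<open>E\<close> only has to contain the points where both \<open>W\<close> and these
  velocities vanish.\<close>

lemma lyapunov_barbalat_convergence:
  fixes F :: "'a::euclidean_space \<Rightarrow> 'a" and P :: "'a \<Rightarrow> 'b::real_normed_vector"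
  assumes K: "compact K" "z \<in> K"
    and x: "\<And>t. t \<ge> 0 \<Longrightarrow> (x has_vector_derivative F (x t)) (at t within {0..})"
    and xK: "\<And>t. t \<ge> 0 \<Longrightarrow> x t \<in> K"
    and V: "\<And>y. GDERIV V y :> Z y" and diss: "\<And>y. Z y \<bullet> F y = - W y" "\<And>y. W y \<ge> 0"
    and W: "continuous_on K W" and F: "continuous_on K F"
    and P: "bounded_linear P"
    and W_P: "\<And>y. y \<in> K \<Longrightarrow> W y = 0 \<Longrightarrow> P y = P z"
    and W_PF: "\<And>y. y \<in> K \<Longrightarrow> W y = 0 \<Longrightarrow> P (F y) = 0 \<Longrightarrow> y \<in> E"
  shows "((\<lambda>t. infdist (x t) E) \<longlongrightarrow> 0) at_top"
proof -
  have x_cont: "continuous_on {0..} x"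
    by (rule continuous_on_vector_derivative[OF x]) simp
  have V_cont: "continuous_on K V"
    using V by (auto simp: gderiv_def intro: has_derivative_continuous continuous_at_imp_continuous_on)
  obtain B where B: "\<And>y. y \<in> K \<Longrightarrow> norm (F y) \<le> B"
    using compact_imp_bounded[OF compact_continuous_image[OF F K(1)]] by (auto simp: bounded_iff)
  have B0: "B \<ge> 0" using B[OF K(2)] norm_ge_zero order_trans by blast
  have "B-lipschitz_on {0..} x"
  proof (rule lipschitz_onI)
    fix s t :: real assume st: "s \<in> {0..}" "t \<in> {0..}"
    have "norm (x s - x t) \<le> B * norm (s - t)"
      by (rule differentiable_bound[of "{0..}" x "\<lambda>t h. h *\<^sub>R F (x t)"])
         (use x st B xK B0 in \<open>auto simp: has_vector_derivative_def mult.commute[of B]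
           intro!: onorm_le mult_left_mono\<close>)
    then show "dist (x s) (x t) \<le> B * dist s t" by (simp add: dist_norm)
  qed (rule B0)
  then have x_unif: "uniformly_continuous_on {0..} x" by (rule lipschitz_on_uniformly_continuous)
  have unif: "uniformly_continuous_on {0..} (\<lambda>t. f (x t))" if "continuous_on K f"
    for f :: "'a \<Rightarrow> 'c::metric_space"
  proof (rule uniformly_continuous_on_compose[OF x_unif])
    have "x ` {0..} \<subseteq> K" using xK by auto
    then show "uniformly_continuous_on (x ` {0..}) f"
      using compact_uniformly_continuous[OF that K(1)]
      unfolding uniformly_continuous_on_def by (meson subsetD)
  qed

  have V_der: "((\<lambda>t. V (x t)) has_vector_derivative - W (x t)) (at t within {0..})" if "t \<ge> 0" for t
    using gradient_chain[where V = V, OF V x[OF that]] by (simp add: diss)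
  have V_mono: "V (x t) \<le> V (x s)" if "0 \<le> s" "s \<le> t" for s t
    by (rule nonincreasing_along[OF V_der]) (use that diss in auto)
  obtain M where M: "\<And>y. y \<in> K \<Longrightarrow> \<bar>V y\<bar> \<le> M"
    using compact_imp_bounded[OF compact_continuous_image[OF V_cont K(1)]] by (auto simp: bounded_iff)
  have "\<exists>l. ((\<lambda>t. V (x t)) \<longlongrightarrow> l) at_top"
  proof -
    define l where "l = (INF t\<in>{0..}. V (x t))"
    have bdd: "bdd_below ((\<lambda>t. V (x t)) ` {0..})"
      using M xK by (intro bdd_belowI2[of _ "- M"]) (force simp: abs_le_iff)
    have "((\<lambda>t. V (x t)) \<longlongrightarrow> l) at_top"
    proof (rule decreasing_tendsto)
      show "\<forall>\<^sub>F t in at_top. l \<le> V (x t)"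
        using eventually_ge_at_top[of 0] by eventually_elim (auto simp: l_def intro!: cINF_lower bdd)
      fix u assume "l < u"
      then obtain s where s: "s \<ge> 0" "V (x s) < u"
        unfolding l_def by (subst (asm) cINF_less_iff[OF _ bdd]) auto
      then show "\<forall>\<^sub>F t in at_top. V (x t) < u"
        using V_mono[OF s(1)] by (meson eventually_at_top_linorderI le_less_trans)
    qed
    then show ?thesis ..
  qed
  then obtain l where "((\<lambda>t. V (x t)) \<longlongrightarrow> l) at_top" ..
  from tendsto_minus[OF barbalat[OF V_der unif[OF continuous_on_minus[OF W]] this]]
  have W_lim: "((\<lambda>t. W (x t)) \<longlongrightarrow> 0) at_top" by simp

  have P_cont: "continuous_on A P" for A by (intro linear_continuous_on P)
  have "((\<lambda>t. norm (P (x t) - P z)) \<longlongrightarrow> 0) at_top"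
    by (rule tendsto_zero_on_compact[OF K(1) xK W _ _ W_lim])
       (auto intro!: continuous_intros P_cont simp: W_P)
  then have "((\<lambda>t. P (x t)) \<longlongrightarrow> P z) at_top"
    by (simp add: tendsto_norm_zero_iff LIM_zero_iff)
  moreover have "((\<lambda>t. P (x t)) has_vector_derivative P (F (x t))) (at t within {0..})"
    if "t \<ge> 0" for t
    by (rule bounded_linear.has_vector_derivative[OF P x[OF that]])
  ultimately have PF_lim: "((\<lambda>t. P (F (x t))) \<longlongrightarrow> 0) at_top"
    by (intro barbalat[of "\<lambda>t. P (x t)"] unif continuous_on_compose2[OF P_cont F]) auto

  show ?thesis
  proof (rule tendsto_zero_on_compact[OF K(1) xK])
    show "((\<lambda>t. W (x t) + norm (P (F (x t)))) \<longlongrightarrow> 0) at_top"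
      using tendsto_add[OF W_lim tendsto_norm_zero[OF PF_lim]] by simp
    show "continuous_on K (\<lambda>y. W y + norm (P (F y)))"
      by (intro continuous_intros W continuous_on_compose2[OF P_cont F]) auto
    show "infdist y E = 0" if "y \<in> K" "W y + norm (P (F y)) = 0" for y
      using that diss(2)[of y] by (intro infdist_zero W_PF) (auto simp: add_nonneg_eq_0_iff)
  qed (auto intro!: continuous_intros)
qed

text \<open>The ball of radius \<open>e\<close> is chosen such that \<open>V\<close> stays below \<open>c * r\<^sup>2\<close> on it, which is the
  height of \<open>V\<close> on the sphere of radius \<open>r\<close>. Solutions are obtained from the field
  precomposed with the nearest-point projection onto the ball, which is bounded and globally
  Lipschitz.\<close>

lemma lyapunov_stability:
  fixes F :: "'a::euclidean_space \<Rightarrow> 'a"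
  assumes S: "subspace S" "\<And>y. F y \<in> S" "z \<in> S"
    and lip: "L-lipschitz_on (cball z r) F" and r: "r > 0"
    and V: "\<And>y. GDERIV V y :> Z y" and diss: "\<And>y. Z y \<bullet> F y \<le> 0"
    and V0: "V z = 0" and c: "c > 0"
    and V_lower: "\<And>y. y \<in> S \<inter> cball z r \<Longrightarrow> c * (dist z y)\<^sup>2 \<le> V y"
  obtains e where "e > 0"
    "\<And>x0. x0 \<in> S \<inter> ball z e \<Longrightarrow> \<exists>x. x 0 = x0 \<and>
       (\<forall>t\<ge>0. x t \<in> S \<and> (x has_vector_derivative F (x t)) (at t within {0..}))"
    "\<And>x t. \<lbrakk>x 0 \<in> S \<inter> ball z e;
       \<And>t. t \<ge> 0 \<Longrightarrow> (x has_vector_derivative F (x t)) (at t within {0..}); t \<ge> 0\<rbrakk>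
       \<Longrightarrow> x t \<in> S \<inter> cball z r"
proof -
  have "isCont V z" using V by (auto simp: gderiv_def intro: has_derivative_continuous)
  then have "\<exists>d>0. \<forall>y. dist y z < d \<longrightarrow> dist (V y) (V z) < c * r\<^sup>2"
    using c r unfolding continuous_at_eps_delta by simp
  then obtain d where d: "d > 0" "\<And>y. dist y z < d \<Longrightarrow> V y < c * r\<^sup>2"
    using V0 by (auto simp: dist_real_def abs_less_iff)
  define e where "e = min d r"
  have e: "e > 0" using d r by (simp add: e_def)
  \<comment> \<open>Stated for every field that agrees with F on the ball, so that it applies to F itself and
    to its truncation.\<close>
  have confined: "x t \<in> S \<inter> ball z r"
    if x0: "x 0 \<in> S \<inter> ball z e"
      and F': "\<And>y. F' y \<in> S" "\<And>y. y \<in> cball z r \<Longrightarrow> F' y = F y"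
      and x: "\<And>t. t \<ge> 0 \<Longrightarrow> (x has_vector_derivative F' (x t)) (at t within {0..})"
      and t: "t \<ge> 0" for x F' and t :: real
  proof -
    have inS: "x t \<in> S" if "t \<ge> 0" for t
      by (rule solution_stays_in_subspace[OF S(1) F'(1) _ x that]) (use x0 in auto)
    have Vx0: "V (x 0) < c * r\<^sup>2" using d x0 by (auto simp: e_def dist_commute)
    have "dist z (x t) < r"
    proof (rule potential_barrier_confines[where V = V, OF _ _ _ _ t])
      show "continuous_on {0..} x" by (rule continuous_on_vector_derivative[OF x]) simp
      show "dist z (x 0) < r" using x0 by (auto simp: e_def)
      fix T :: real assume T: "T \<ge> 0"
      show "V (x T) \<le> V (x 0)" if inside: "\<And>s. \<lbrakk>0 \<le> s; s \<le> T\<rbrakk> \<Longrightarrow> dist z (x s) \<le> r"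
      proof (rule nonincreasing_along[where f = "\<lambda>s. V (x s)" and f' = "\<lambda>s. Z (x s) \<bullet> F' (x s)"])
        fix s assume s: "0 \<le> s" "s \<le> T"
        show "((\<lambda>s. V (x s)) has_vector_derivative (Z (x s) \<bullet> F' (x s))) (at s within {0..})"
          by (rule gradient_chain[where V = V, OF V x[OF s(1)]])
        show "Z (x s) \<bullet> F' (x s) \<le> 0" using F'(2) inside[OF s] diss by simp
      qed (use T in auto)
      show "V (x 0) < V (x T)" if "dist z (x T) = r"
        using V_lower[of "x T"] inS[OF T] that Vx0 by simp
    qed
    with inS[OF t] show ?thesis by simp
  qed
  show ?thesis
  proof (rule that[OF e])
    fix x and t :: real assume "x 0 \<in> S \<inter> ball z e" "t \<ge> 0"
      "\<And>t. t \<ge> 0 \<Longrightarrow> (x has_vector_derivative F (x t)) (at t within {0..})"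
    then have "x t \<in> S \<inter> ball z r"
      by (intro confined[of x F t]) (auto simp: S)
    then show "x t \<in> S \<inter> cball z r" by simp
  next
    fix x0 assume x0: "x0 \<in> S \<inter> ball z e"
    define \<pi> where "\<pi> = closest_point (cball z r)"
    have \<pi>_in: "\<pi> y \<in> cball z r" for y
      unfolding \<pi>_def using r by (intro closest_point_in_set) auto
    have \<pi>_self: "\<pi> y = y" if "y \<in> cball z r" for y
      unfolding \<pi>_def by (rule closest_point_self[OF that])
    have "1-lipschitz_on UNIV \<pi>"
      using r by (intro lipschitz_onI) (auto simp: \<pi>_def intro!: closest_point_lipschitz)
    then have lip': "(L * 1)-lipschitz_on UNIV (F \<circ> \<pi>)"
      by (intro lipschitz_on_compose lipschitz_on_subset[OF lip]) (use \<pi>_in in auto)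
    have bdd: "bounded (range (F \<circ> \<pi>))"
      by (rule bounded_subset[OF compact_imp_bounded[OF
            compact_continuous_image[OF lipschitz_on_continuous_on[OF lip] compact_cball]]])
         (use \<pi>_in in auto)
    obtain x where x: "x 0 = x0"
      "\<And>t. t \<ge> 0 \<Longrightarrow> (x has_vector_derivative (F \<circ> \<pi>) (x t)) (at t within {0..})"
      using bounded_lipschitz_field_has_global_solution[OF lip' bdd, of x0] by blast
    have "x t \<in> S \<inter> ball z r" if "t \<ge> 0" for t :: real
      by (rule confined[of x "F \<circ> \<pi>"]) (use x x0 S \<pi>_self that in auto)
    then have "x t \<in> S \<and> (x has_vector_derivative F (x t)) (at t within {0..})" if "t \<ge> 0" for t :: real
      using x(2)[OF that] \<pi>_self[of "x t"] that by fastforce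
    with x(1) show "\<exists>x. x 0 = x0 \<and>
       (\<forall>t\<ge>0. x t \<in> S \<and> (x has_vector_derivative F (x t)) (at t within {0..}))"
      by blast
  qed
qed

section \<open>Functions built from coordinates by ring operations, sine and cosine\<close>

text \<open>The Hamiltonian is built from linear coordinates by ring operations, sine and cosine. This
  class of functions is closed under differentiation, so all the regularity that is needed (a
  gradient everywhere, a differentiable gradient, local Lipschitz bounds) follows without
  computing a single derivative of the edge energies.\<close>

inductive trig_expr :: "('a::euclidean_space \<Rightarrow> real) \<Rightarrow> bool" where
  const: "trig_expr (\<lambda>_. c)"
| linear: "bounded_linear l \<Longrightarrow> trig_expr l"
| add: "trig_expr f \<Longrightarrow> trig_expr g \<Longrightarrow> trig_expr (\<lambda>x. f x + g x)"
| mult: "trig_expr f \<Longrightarrow> trig_expr g \<Longrightarrow> trig_expr (\<lambda>x. f x * g x)"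
| sin: "trig_expr f \<Longrightarrow> trig_expr (\<lambda>x. sin (f x))"
| cos: "trig_expr f \<Longrightarrow> trig_expr (\<lambda>x. cos (f x))"

lemma trig_expr_minus: "trig_expr f \<Longrightarrow> trig_expr (\<lambda>x. - f x)"
  using trig_expr.mult[OF trig_expr.const[of "- 1"], of f] by simp

lemma trig_expr_diff: "trig_expr f \<Longrightarrow> trig_expr g \<Longrightarrow> trig_expr (\<lambda>x. f x - g x)"
  using trig_expr.add[OF _ trig_expr_minus, of f g] by simp

lemma trig_expr_divide: "trig_expr f \<Longrightarrow> trig_expr (\<lambda>x. f x / c)"
  using trig_expr.mult[OF _ trig_expr.const[of "inverse c"], of f] by (simp add: divide_inverse)

lemma trig_expr_power: "trig_expr f \<Longrightarrow> trig_expr (\<lambda>x. f x ^ n)"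
  by (induction n) (auto intro: trig_expr.const trig_expr.mult)

lemma trig_expr_sum: "(\<And>i. i \<in> I \<Longrightarrow> trig_expr (f i)) \<Longrightarrow> trig_expr (\<lambda>x. \<Sum>i\<in>I. f i x)"
  by (induction I rule: infinite_finite_induct) (auto intro: trig_expr.const trig_expr.add)

lemmas trig_expr_intros = trig_expr.const trig_expr.add trig_expr.mult trig_expr.sin trig_expr.cos
  trig_expr_minus trig_expr_diff trig_expr_divide trig_expr_power trig_expr_sum

lemma trig_expr_linear: "linear l \<Longrightarrow> trig_expr l"
  by (rule trig_expr.linear) (simp add: linear_conv_bounded_linear)

definition trig_field :: "('a::euclidean_space \<Rightarrow> 'a) \<Rightarrow> bool" where
  "trig_field F \<longleftrightarrow> (\<forall>v. trig_expr (\<lambda>x. F x \<bullet> v))"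

text \<open>Moving \<open>A\<close> to the other side of the inner product expresses the components of \<open>A (G x)\<close> by
  those of \<open>G x\<close>.\<close>

lemma trig_field_linear_image:
  assumes "linear A" "trig_field G"
  shows "trig_field (\<lambda>x. A (G x) - b)"
  unfolding trig_field_def
proof
  fix v
  have "(\<lambda>x. (A (G x) - b) \<bullet> v) = (\<lambda>x. G x \<bullet> adjoint A v - b \<bullet> v)"
    by (simp add: inner_diff_left adjoint_works[OF assms(1)])
  then show "trig_expr (\<lambda>x. (A (G x) - b) \<bullet> v)"
    using assms(2) by (auto simp: trig_field_def intro!: trig_expr_intros)
qed

text \<open>Closure under differentiation, by the sum, product and chain rules.\<close>

lemma trig_expr_has_trig_gradient:
  assumes "trig_expr f"
  shows "\<exists>G. (\<forall>x. GDERIV f x :> G x) \<and> trig_field G"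
  using assms
proof (induction rule: trig_expr.induct)
  case (const c)
  show ?case
    by (rule exI[of _ "\<lambda>_. 0"]) (auto simp: GDERIV_const trig_field_def intro: trig_expr.const)
next
  case (linear l)
  define g where "g = (\<Sum>b\<in>Basis. l b *\<^sub>R b)"
  interpret bounded_linear l by fact
  have "l h = h \<bullet> g" for h
  proof -
    have "l h = l (\<Sum>b\<in>Basis. (h \<bullet> b) *\<^sub>R b)" by (simp add: euclidean_representation)
    then show ?thesis by (simp add: sum scaleR g_def inner_sum_right mult.commute)
  qed
  then have "l = (\<lambda>h. h \<bullet> g)" by auto
  then have "GDERIV l x :> g" for x
    by (auto simp: gderiv_def intro!: derivative_eq_intros)
  then show ?case
    by (intro exI[of _ "\<lambda>_. g"]) (auto simp: trig_field_def intro: trig_expr.const)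
next
  case (add f g)
  then obtain F G where "\<And>x. GDERIV f x :> F x" "\<And>x. GDERIV g x :> G x" "trig_field F" "trig_field G"
    by blast
  then show ?case
    by (intro exI[of _ "\<lambda>x. F x + G x"])
       (auto simp: trig_field_def inner_add_left intro!: GDERIV_add trig_expr_intros)
next
  case (mult f g)
  then obtain F G where "\<And>x. GDERIV f x :> F x" "\<And>x. GDERIV g x :> G x" "trig_field F" "trig_field G"
    by blast
  with mult show ?case
    by (intro exI[of _ "\<lambda>x. f x *\<^sub>R G x + g x *\<^sub>R F x"])
       (auto simp: trig_field_def inner_add_left intro!: GDERIV_mult trig_expr_intros)
next
  case (sin f)
  then obtain F where "\<And>x. GDERIV f x :> F x" "trig_field F" by blast
  with sin show ?case
    by (intro exI[of _ "\<lambda>x. cos (f x) *\<^sub>R F x"])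
       (auto simp: trig_field_def intro!: GDERIV_DERIV_compose[of f _ _ sin] DERIV_sin trig_expr_intros)
next
  case (cos f)
  then obtain F where "\<And>x. GDERIV f x :> F x" "trig_field F" by blast
  with cos show ?case
    by (intro exI[of _ "\<lambda>x. - sin (f x) *\<^sub>R F x"])
       (auto simp del: scaleR_minus_left
         simp: trig_field_def intro!: GDERIV_DERIV_compose[of f _ _ cos] DERIV_cos trig_expr_intros)
qed

lemma trig_expr_continuous: "trig_expr f \<Longrightarrow> continuous_on A f"
  using trig_expr_has_trig_gradient[of f] unfolding gderiv_def
  by (meson continuous_at_imp_continuous_on has_derivative_continuous)

lemma trig_field_continuous: "trig_field F \<Longrightarrow> continuous_on A F"
  by (subst continuous_on_componentwise) (auto simp: trig_field_def intro: trig_expr_continuous)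

lemma trig_field_differentiable: "trig_field F \<Longrightarrow> F differentiable (at x)"
  using trig_expr_has_trig_gradient
  by (subst differentiable_componentwise_within)
     (fastforce simp: trig_field_def gderiv_def differentiable_def)

lemma trig_expr_lipschitz_on_cball:
  assumes "trig_expr f"
  shows "\<exists>L. L-lipschitz_on (cball z r) f"
proof -
  obtain G where G: "\<And>x. GDERIV f x :> G x" "trig_field G"
    using trig_expr_has_trig_gradient[OF assms] by auto
  have "compact (G ` cball z r)"
    by (intro compact_continuous_image trig_field_continuous G compact_cball)
  then obtain B where B: "B > 0" "\<And>x. x \<in> cball z r \<Longrightarrow> norm (G x) \<le> B"
    using compact_imp_bounded bounded_pos by (metis image_eqI)
  have "norm (f x - f y) \<le> B * norm (x - y)" if "x \<in> cball z r" "y \<in> cball z r" for x y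
  proof (rule differentiable_bound[OF convex_cball _ _ that(1,2)])
    show "(f has_derivative (\<lambda>h. h \<bullet> G u)) (at u within cball z r)" for u
      using G(1)[of u] by (auto simp: gderiv_def intro: has_derivative_at_withinI)
    show "onorm (\<lambda>h. h \<bullet> G u) \<le> B" if "u \<in> cball z r" for u
    proof (rule onorm_le)
      fix h
      have "norm (h \<bullet> G u) \<le> norm h * norm (G u)" by (rule Cauchy_Schwarz_ineq2[folded real_norm_def])
      also have "\<dots> \<le> norm h * B" using B(2)[OF that] by (rule mult_left_mono) simp
      finally show "norm (h \<bullet> G u) \<le> B * norm h" by (simp add: mult.commute)
    qed
  qed
  then show ?thesis using B(1)
    by (intro exI[of _ B] lipschitz_onI) (auto simp: dist_norm)
qed

lemma trig_field_lipschitz_on_cball: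
  assumes "trig_field F"
  shows "\<exists>L. L-lipschitz_on (cball z r) F"
proof -
  have "\<forall>b. \<exists>L. L-lipschitz_on (cball z r) (\<lambda>x. F x \<bullet> b)"
    using assms unfolding trig_field_def by (intro allI trig_expr_lipschitz_on_cball) simp
  then obtain L where L: "\<And>b. (L b)-lipschitz_on (cball z r) (\<lambda>x. F x \<bullet> b)" by metis
  have "dist (F x) (F y) \<le> (\<Sum>b\<in>Basis. L b) * dist x y"
    if "x \<in> cball z r" "y \<in> cball z r" for x y
  proof -
    have "dist (F x) (F y) \<le> (\<Sum>b\<in>Basis. \<bar>(F x - F y) \<bullet> b\<bar>)"
      unfolding dist_norm by (rule norm_le_l1)
    also have "\<dots> \<le> (\<Sum>b\<in>Basis. L b * dist x y)"
      using lipschitz_onD[OF L that] by (intro sum_mono) (simp add: dist_real_def inner_diff_left)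
    finally show ?thesis by (simp add: sum_distrib_right)
  qed
  then show ?thesis
    by (intro exI lipschitz_onI) (auto intro: sum_nonneg lipschitz_on_nonneg[OF L])
qed

lemma gradient_eq: "GDERIV f x :> d \<Longrightarrow> gradient f x = d"
  unfolding gradient_def
proof (rule the_equality)
  fix d' assume "GDERIV f x :> d'" "GDERIV f x :> d"
  from has_derivative_unique[OF this[unfolded gderiv_def]]
  have "\<And>h. h \<bullet> d' = h \<bullet> d" by meson
  then show "d' = d" by (metis inner_eq_zero_iff inner_diff_right right_minus_eq)
qed

lemma trig_expr_GDERIV: "trig_expr f \<Longrightarrow> GDERIV f x :> gradient f x"
  using trig_expr_has_trig_gradient gradient_eq by metis

lemma trig_expr_gradient: "trig_expr f \<Longrightarrow> trig_field (gradient f)"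
  using trig_expr_has_trig_gradient[of f] gradient_eq by (metis ext)

section \<open>Quadratic growth at a point with positive definite Hessian\<close>

text \<open>The quadratic form attains a positive minimum on the unit sphere of \<open>S\<close>; the rest is
  homogeneity.\<close>

lemma positive_definite_on_coercive:
  fixes A :: "'a::euclidean_space \<Rightarrow> 'a"
  assumes S: "subspace S" and A: "linear A" and pos: "positive_definite_on S A"
  obtains m where "m > 0" "\<And>v. v \<in> S \<Longrightarrow> m * (norm v)\<^sup>2 \<le> v \<bullet> A v"
proof -
  interpret linear A by fact
  have comp: "compact (S \<inter> sphere 0 1)"
    by (intro closed_Int_compact closed_subspace S compact_sphere)
  have cont: "continuous_on T (\<lambda>v. v \<bullet> A v)" for T
    using A by (intro continuous_intros linear_continuous_on) (simp add: linear_conv_bounded_linear)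
  have "\<exists>m>0. \<forall>v\<in>S \<inter> sphere 0 1. m \<le> v \<bullet> A v"
  proof (cases "S \<inter> sphere 0 1 = {}")
    case False
    from continuous_attains_inf[OF comp False cont] obtain u
      where u: "u \<in> S" "norm u = 1" "\<forall>v\<in>S \<inter> sphere 0 1. u \<bullet> A u \<le> v \<bullet> A v" by auto
    then have "u \<bullet> A u > 0" using pos by (auto simp: positive_definite_on_def)
    with u show ?thesis by blast
  qed (auto intro: exI[of _ 1])
  then obtain m where m: "m > 0" "\<And>v. v \<in> S \<Longrightarrow> norm v = 1 \<Longrightarrow> m \<le> v \<bullet> A v" by auto
  show ?thesis
  proof (rule that[OF m(1)])
    fix v assume v: "v \<in> S"
    show "m * (norm v)\<^sup>2 \<le> v \<bullet> A v"
    proof (cases "v = 0")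
      case False
      define u where "u = (1 / norm v) *\<^sub>R v"
      have "m \<le> u \<bullet> A u"
        using False v by (intro m) (auto simp: u_def subspace_scale[OF S])
      also have "\<dots> = v \<bullet> A v / (norm v)\<^sup>2"
        by (simp add: u_def scale power2_eq_square)
      finally show ?thesis using False by (simp add: field_simps)
    qed (simp add: zero)
  qed
qed

text \<open>Differentiability of the gradient at \<open>z\<close> yields, near \<open>z\<close>,
  \<open>(G (z + v) - G z) \<bullet> v \<ge> m/2 * (norm v)\<^sup>2\<close> for \<open>v \<in> S\<close>, and this is integrated along the
  segment from \<open>z\<close> to \<open>y\<close>.\<close>

lemma positive_definite_hessian_quadratic_growth:
  fixes H :: "'a::euclidean_space \<Rightarrow> real"
  assumes S: "subspace S" and z: "z \<in> S"
    and H: "\<And>x. GDERIV H x :> G x" and A: "(G has_derivative A) (at z)"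
    and pos: "positive_definite_on S A"
  obtains c r where "c > 0" "r > 0"
    "\<And>y. y \<in> S \<inter> cball z r \<Longrightarrow> c * (dist z y)\<^sup>2 \<le> H y - H z - G z \<bullet> (y - z)"
proof -
  obtain m where m: "m > 0" "\<And>v. v \<in> S \<Longrightarrow> m * (norm v)\<^sup>2 \<le> v \<bullet> A v"
    using positive_definite_on_coercive[OF S has_derivative_linear[OF A] pos] by blast
  obtain d where d: "d > 0"
    and lin: "\<And>y. norm (y - z) < d \<Longrightarrow> norm (G y - G z - A (y - z)) \<le> m / 2 * norm (y - z)"
    using A m(1) unfolding has_derivative_at_alt by (metis half_gt_zero)
  have mono: "m / 2 * (norm v)\<^sup>2 \<le> (G (z + v) - G z) \<bullet> v" if v: "v \<in> S" "norm v < d" for v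
  proof -
    have "\<bar>(G (z + v) - G z - A v) \<bullet> v\<bar> \<le> norm (G (z + v) - G z - A v) * norm v"
      by (rule Cauchy_Schwarz_ineq2)
    also have "\<dots> \<le> (m / 2 * norm v) * norm v"
      using lin[of "z + v"] v by (intro mult_right_mono) auto
    finally have "- (m / 2 * (norm v)\<^sup>2) \<le> (G (z + v) - G z - A v) \<bullet> v"
      by (simp add: power2_eq_square mult.assoc abs_le_iff)
    then show ?thesis
      using m(2)[OF v(1)] by (simp add: inner_diff_left inner_commute[of "A v" v])
  qed
  show ?thesis
  proof (rule that[of "m / 4" "d / 2"])
    fix y assume y: "y \<in> S \<inter> cball z (d / 2)"
    define h where "h = y - z"
    have h: "h \<in> S" "norm h < d"
      using y z d by (auto simp: h_def subspace_diff[OF S] dist_norm norm_minus_commute)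
    define \<phi> where "\<phi> s = H (z + s *\<^sub>R h) - s * (G z \<bullet> h) - m / 4 * s\<^sup>2 * (norm h)\<^sup>2" for s
    \<comment> \<open>The quadratic term is what remains of the monotonicity bound after integration: half of m / 2.\<close>
    have "\<phi> 0 \<le> \<phi> 1"
    proof (rule DERIV_nonneg_imp_nondecreasing[where f = \<phi>])
      fix s :: real assume s: "0 \<le> s" "s \<le> 1"
      have "((\<lambda>s. H (z + s *\<^sub>R h)) has_derivative (\<lambda>u. (u *\<^sub>R h) \<bullet> G (z + s *\<^sub>R h))) (at s)"
        by (rule has_derivative_compose[where g = H])
           (use H in \<open>auto simp: gderiv_def intro!: derivative_eq_intros\<close>)
      then have H': "DERIV (\<lambda>s. H (z + s *\<^sub>R h)) s :> h \<bullet> G (z + s *\<^sub>R h)"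
        by (simp add: has_field_derivative_def mult_commute_abs)
      define \<phi>' where "\<phi>' = (G (z + s *\<^sub>R h) - G z) \<bullet> h - m / 2 * s * (norm h)\<^sup>2"
      have "DERIV \<phi> s :> \<phi>'"
        unfolding \<phi>_def[abs_def] \<phi>'_def
        by (rule derivative_eq_intros H' refl)+ (simp add: inner_diff_left inner_commute[of h])
      moreover have "\<phi>' \<ge> 0"
      proof (cases "s = 0")
        case False
        have "norm (s *\<^sub>R h) < d"
          using s h mult_left_le_one_le[of "norm h" s] by simp
        from mono[OF subspace_scale[OF S h(1)] this]
        have "s * (m / 2 * s * (norm h)\<^sup>2) \<le> s * ((G (z + s *\<^sub>R h) - G z) \<bullet> h)"
          by (simp add: power_mult_distrib power2_eq_square mult_ac)
        then show ?thesis using False s by (simp add: \<phi>'_def)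
      qed (simp add: \<phi>'_def)
      ultimately show "\<exists>y. DERIV \<phi> s :> y \<and> 0 \<le> y" by blast
    qed simp
    then show "m / 4 * (dist z y)\<^sup>2 \<le> H y - H z - G z \<bullet> (y - z)"
      by (simp add: \<phi>_def h_def dist_norm norm_minus_commute)
  qed (use m d in auto)
qed

section \<open>Diagonal, Laplacian and incidence matrices\<close>

lemma diagm_mult_vec: "(diagm d *v x) $ i = d i * x $ i"
  by (simp add: matrix_vector_mult_def diagm_def if_distrib if_distribR sum.delta' cong: if_cong)

lemma invertible_matrix_inv:
  assumes "invertible A"
  shows "A ** matrix_inv A = mat 1" "matrix_inv A ** A = mat 1"
  using someI_ex[OF assms[unfolded invertible_def]] by (auto simp: matrix_inv_def)

lemma matrix_inv_eqI:
  assumes "A ** B = mat 1" "B ** A = mat 1"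
  shows "matrix_inv A = B"
proof -
  have "invertible A" using assms by (auto simp: invertible_def)
  then show ?thesis
    by (metis assms(2) invertible_matrix_inv(1) matrix_mul_assoc matrix_mul_lid matrix_mul_rid)
qed

lemma matrix_inv_diagm:
  fixes d :: "'n::finite \<Rightarrow> real"
  assumes "\<And>i. d i \<noteq> 0"
  shows "matrix_inv (diagm d) = diagm (\<lambda>i. inverse (d i))"
proof (rule matrix_inv_eqI)
  show "diagm d ** diagm (\<lambda>i. inverse (d i)) = mat 1"
    "diagm (\<lambda>i. inverse (d i)) ** diagm d = mat 1"
    using assms
    by (auto simp: matrix_eq vec_eq_iff diagm_mult_vec simp flip: matrix_vector_mul_assoc)
qed

lemma matrix_inv_diagm_mult_vec:
  "(\<And>i. d i \<noteq> 0) \<Longrightarrow> (matrix_inv (diagm d) *v x) $ i = x $ i / d i"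
  by (simp add: matrix_inv_diagm diagm_mult_vec divide_inverse)

lemma laplacian_mult_vec:
  "(laplacian w *v v) $ i = (\<Sum>j\<in>UNIV. w i j * (v $ i - v $ j))"
proof -
  have "(laplacian w *v v) $ i = (\<Sum>j\<in>UNIV. laplacian w $ i $ j * v $ j)"
    by (simp add: matrix_vector_mult_def)
  also have "\<dots> = laplacian w $ i $ i * v $ i + (\<Sum>j\<in>UNIV - {i}. laplacian w $ i $ j * v $ j)"
    by (subst sum.remove[of _ i]) auto
  also have "\<dots> = (\<Sum>j\<in>UNIV - {i}. w i j * (v $ i - v $ j))"
    by (simp add: laplacian_def sum_distrib_right sum_negf right_diff_distrib sum_subtractf)
  also have "\<dots> = (\<Sum>j\<in>UNIV. w i j * (v $ i - v $ j))"
    by (subst (2) sum.remove[of _ i]) auto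
  finally show ?thesis .
qed

text \<open>Symmetrizing the double sum in the two indices.\<close>

lemma laplacian_quadratic_form:
  assumes sym: "\<And>i k. w i k = w k i"
  shows "v \<bullet> (laplacian w *v v) = 1/2 * (\<Sum>i\<in>UNIV. \<Sum>j\<in>UNIV. w i j * (v $ i - v $ j)\<^sup>2)"
proof -
  let ?q = "\<Sum>i\<in>UNIV. \<Sum>j\<in>UNIV. w i j * (v $ i * (v $ i - v $ j))"
  have q: "v \<bullet> (laplacian w *v v) = ?q"
    by (simp add: inner_vec_def laplacian_mult_vec sum_distrib_left mult_ac)
  have "?q = (\<Sum>i\<in>UNIV. \<Sum>j\<in>UNIV. w i j * (v $ j * (v $ j - v $ i)))"
    by (subst sum.swap) (simp add: sym)
  then have "?q + ?q = (\<Sum>i\<in>UNIV. \<Sum>j\<in>UNIV.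
      w i j * (v $ i * (v $ i - v $ j)) + w i j * (v $ j * (v $ j - v $ i)))"
    by (simp add: sum.distrib)
  also have "\<dots> = (\<Sum>i\<in>UNIV. \<Sum>j\<in>UNIV. w i j * (v $ i - v $ j)\<^sup>2)"
    by (intro sum.cong refl) (simp add: power2_eq_square algebra_simps)
  finally show ?thesis unfolding q by simp
qed

lemma laplacian_psd:
  assumes "\<And>i k. w i k = w k i" "\<And>i k. w i k \<ge> 0"
  shows "v \<bullet> (laplacian w *v v) \<ge> 0"
  using assms by (simp add: laplacian_quadratic_form sum_nonneg)

lemma laplacian_null_edges:
  assumes "\<And>i k. w i k = w k i" "\<And>i k. w i k \<ge> 0" "v \<bullet> (laplacian w *v v) = 0"
  shows "w i k = 0 \<or> v $ i = v $ k"
proof -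
  have "(\<Sum>i\<in>UNIV. \<Sum>j\<in>UNIV. w i j * (v $ i - v $ j)\<^sup>2) = 0"
    using assms by (simp add: laplacian_quadratic_form)
  then have "w i k * (v $ i - v $ k)\<^sup>2 = 0"
    using assms(2) by (simp add: sum_nonneg_eq_0_iff sum_nonneg)
  then show ?thesis by simp
qed

lemma connected_rel_constant:
  assumes "connected_rel E" "\<And>i k. (i, k) \<in> E \<Longrightarrow> f i = f k"
  shows "f i = f k"
proof -
  have "(i, k) \<in> (E \<union> E\<inverse>)\<^sup>*" using assms(1) by (simp add: connected_rel_def)
  then show ?thesis by (induction rule: rtrancl_induct) (use assms(2) in \<open>fastforce+\<close>)
qed

lemma vec_mult_incidence:
  assumes "fst l \<noteq> snd l"
  shows "(p v* incidence N) $ l = (if l \<in> edges N then p $ fst l - p $ snd l else 0)"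
proof -
  have "(p v* incidence N) $ l = (\<Sum>i\<in>UNIV. p $ i * incidence N $ i $ l)"
    by (simp add: vector_matrix_mult_def mult.commute)
  also have "\<dots> = (\<Sum>i\<in>UNIV. (if i = fst l then (if l \<in> edges N then p $ i else 0) else 0)
      - (if i = snd l then (if l \<in> edges N then p $ i else 0) else 0))"
    using assms by (intro sum.cong refl) (auto simp: incidence_def)
  finally show ?thesis by (simp add: sum_subtractf)
qed

lemma vec_mult_incidence_off_edges: "l \<notin> edges N \<Longrightarrow> (p v* incidence N) $ l = 0"
  by (simp add: vector_matrix_mult_def incidence_def)

lemma asym_no_loop: "asym E \<Longrightarrow> l \<in> E \<Longrightarrow> fst l \<noteq> snd l"
  by (metis asymD prod.collapse)

lemma incidence_column_sums:
  assumes "asym (edges N)"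
  shows "vec 1 v* incidence N = 0"
  using assms vec_mult_incidence[OF asym_no_loop] vec_mult_incidence_off_edges
  by (metis (no_types, lifting) diff_self vec_component vec_eq_iff zero_index)

text \<open>The double sum is antisymmetric in the two indices.\<close>

lemma laplacian_column_sums:
  assumes sym: "\<And>i k. w i k = w k i"
  shows "vec 1 \<bullet> (laplacian w *v v) = 0"
proof -
  let ?q = "\<Sum>i\<in>UNIV. \<Sum>j\<in>UNIV. w i j * (v $ i - v $ j)"
  have "?q = (\<Sum>i\<in>UNIV. \<Sum>j\<in>UNIV. w i j * (v $ j - v $ i))"
    by (subst sum.swap) (simp add: sym)
  also have "\<dots> = - ?q"
    by (simp add: sum_negf[symmetric] flip: mult_minus_right)
  finally show ?thesis by (simp add: inner_vec_def laplacian_mult_vec)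
qed

section \<open>Dissipation of the closed loop\<close>

text \<open>The matrix with blocks \<open>J - R - R\<^sub>K\<close>, \<open>G\<^sup>T\<close>, \<open>- G\<close> and \<open>- L\<^sub>c\<close>.\<close>

definition structure_map :: "'n::finite network \<Rightarrow> 'n controller \<Rightarrow> 'n state \<Rightarrow> 'n state" where
  "structure_map N C = (\<lambda>(u, v).
     (J_minus_R N u - R_K C u + G_out_transpose C v,
      - G_out C u - laplacian (comm_weight C) *v v))"

lemma closed_loop_eq:
  "closed_loop N C Pd x = structure_map N C (gradient (H_total N C) x) - (g_in Pd, 0)"
  by (simp add: closed_loop_def structure_map_def split: prod.splits)

lemma structure_map_unfold:
  "structure_map N C ((p, \<eta>, a, b, c, d), v) =
    ((- (incidence N *v \<eta>) - diagm (gain C) *v p + v v* matrix_inv (cost C),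
      p v* incidence N,
      - ((matrix_inv (diagm (Td' N)) ** diagm (\<lambda>i. Xd N i - Xd' N i)) *v (a + c)),
      - ((matrix_inv (diagm (Tq' N)) ** diagm (\<lambda>i. Xq N i - Xq' N i)) *v (b + d)),
      - ((matrix_inv (diagm (Td'' N)) ** diagm (\<lambda>i. Xd' N i - Xd'' N i)) *v c),
      - ((matrix_inv (diagm (Tq'' N)) ** diagm (\<lambda>i. Xq' N i - Xq'' N i)) *v d)),
     - (matrix_inv (cost C) *v p) - laplacian (comm_weight C) *v v)"
  by (simp add: structure_map_def J_minus_R_def R_K_def G_out_transpose_def G_out_def Let_def
      matrix_vector_right_distrib)

lemma linear_structure_map: "linear (structure_map N C)"
proof (rule linearI)
  show "structure_map N C (x + y) = structure_map N C x + structure_map N C y" for x y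
    by (cases x; cases y; case_tac "fst x"; case_tac "fst y")
       (simp add: structure_map_unfold matrix_vector_right_distrib vector_matrix_left_distrib)
  show "structure_map N C (r *\<^sub>R x) = r *\<^sub>R structure_map N C x" for r x
    by (cases x; case_tac "fst x")
       (simp add: structure_map_unfold matrix_vector_right_distrib matrix_vector_mult_scaleR
          scaleR_vector_matrix_assoc[symmetric]
          scaleR_right_distrib scaleR_right_diff_distrib)
qed

lemma mem_state_space: "((p, \<eta>, a, b, c, d), v) \<in> state_space N \<longleftrightarrow> (\<forall>l. l \<notin> edges N \<longrightarrow> \<eta> $ l = 0)"
  by (auto simp: state_space_def)

lemma subspace_state_space: "subspace (state_space N)"
  unfolding subspace_def state_space_def by (auto simp: zero_prod_def)

lemma closed_loop_in_state_space: "closed_loop N C Pd x \<in> state_space N"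
proof -
  obtain p \<eta> a b c d v where "gradient (H_total N C) x = ((p, \<eta>, a, b, c, d), v)"
    by (metis surj_pair)
  then show ?thesis
    by (simp add: closed_loop_eq structure_map_unfold g_in_def mem_state_space
        vec_mult_incidence_off_edges)
qed

text \<open>The quadratic form to which the resistive block matrix reduces at one node and one axis:
  \<open>x\<close> and \<open>y\<close> are the derivatives of the Hamiltonian with respect to the transient and the
  subtransient voltage. It is not diagonal, because the transient dynamics also contain the
  derivative with respect to the subtransient voltage.\<close>

definition axis_dissipation :: "real \<Rightarrow> real \<Rightarrow> real \<Rightarrow> real \<Rightarrow> real" where
  "axis_dissipation \<alpha> \<beta> x y = \<alpha> * (x\<^sup>2 + x * y) + \<beta> * y\<^sup>2"

text \<open>Completing the square: \<open>\<alpha> * (x + y/2)\<^sup>2 + (\<beta> - \<alpha>/4) * y\<^sup>2\<close>.\<close>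

lemma axis_dissipation_pos:
  assumes "\<alpha> > 0" "4 * \<beta> > \<alpha>"
  shows "axis_dissipation \<alpha> \<beta> x y \<ge> 0"
    and "axis_dissipation \<alpha> \<beta> x y = 0 \<Longrightarrow> x = 0 \<and> y = 0"
proof -
  have eq: "axis_dissipation \<alpha> \<beta> x y = \<alpha> * (x + y / 2)\<^sup>2 + (\<beta> - \<alpha> / 4) * y\<^sup>2"
    by (simp add: axis_dissipation_def power2_eq_square field_simps)
  show "axis_dissipation \<alpha> \<beta> x y \<ge> 0" using assms by (simp add: eq)
  assume "axis_dissipation \<alpha> \<beta> x y = 0"
  moreover have "\<alpha> * (x + y / 2)\<^sup>2 \<ge> 0" "(\<beta> - \<alpha> / 4) * y\<^sup>2 \<ge> 0" using assms by auto
  ultimately have "\<alpha> * (x + y / 2)\<^sup>2 = 0" "(\<beta> - \<alpha> / 4) * y\<^sup>2 = 0" unfolding eq by linarith+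
  then show "x = 0 \<and> y = 0" using assms by auto
qed

definition dissipation :: "'n::finite network \<Rightarrow> 'n controller \<Rightarrow> 'n state \<Rightarrow> real" where
  "dissipation N C = (\<lambda>((p, \<eta>, a, b, c, d), v).
     (\<Sum>i\<in>UNIV. gain C i * (p $ i)\<^sup>2
       + axis_dissipation ((Xd N i - Xd' N i) / Td' N i) ((Xd' N i - Xd'' N i) / Td'' N i) (a $ i) (c $ i)
       + axis_dissipation ((Xq N i - Xq' N i) / Tq' N i) ((Xq' N i - Xq'' N i) / Tq'' N i) (b $ i) (d $ i))
     + v \<bullet> (laplacian (comm_weight C) *v v))"

text \<open>The couplings through the incidence matrix and through \<open>Q\<^sup>-\<^sup>1\<close> occur with opposite signs in
  the two places and cancel.\<close>

lemma inner_structure_map: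
  assumes "network_ok N"
  shows "y \<bullet> structure_map N C y = - dissipation N C y"
proof -
  obtain p \<eta> a b c d v where y: "y = ((p, \<eta>, a, b, c, d), v)"
    by (metis surj_pair)
  have nz: "Td' N i \<noteq> 0" "Tq' N i \<noteq> 0" "Td'' N i \<noteq> 0" "Tq'' N i \<noteq> 0" for i
    using assms by (auto simp: network_ok_def dest!: spec[of _ i])
  have 1: "x \<bullet> ((matrix_inv (diagm T) ** diagm X) *v z) = (\<Sum>i\<in>UNIV. X i / T i * (x $ i * z $ i))"
    if "\<And>i. T i \<noteq> 0" for T X and x z :: "real^'n"
    using that
    by (simp add: inner_vec_def matrix_inv_diagm_mult_vec diagm_mult_vec mult_ac
        flip: matrix_vector_mul_assoc)
  have 2: "p \<bullet> (incidence N *v \<eta>) = \<eta> \<bullet> (p v* incidence N)"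
    by (metis dot_lmul_matrix inner_commute)
  have 3: "p \<bullet> (v v* matrix_inv (cost C)) = v \<bullet> (matrix_inv (cost C) *v p)"
    by (metis dot_lmul_matrix inner_commute)
  have 4: "p \<bullet> (diagm (gain C) *v p) = (\<Sum>i\<in>UNIV. gain C i * (p $ i)\<^sup>2)"
    by (simp add: inner_vec_def diagm_mult_vec power2_eq_square mult_ac)
  have "dissipation N C y = p \<bullet> (diagm (gain C) *v p) + v \<bullet> (laplacian (comm_weight C) *v v)
    + a \<bullet> ((matrix_inv (diagm (Td' N)) ** diagm (\<lambda>i. Xd N i - Xd' N i)) *v (a + c))
    + b \<bullet> ((matrix_inv (diagm (Tq' N)) ** diagm (\<lambda>i. Xq N i - Xq' N i)) *v (b + d))
    + c \<bullet> ((matrix_inv (diagm (Td'' N)) ** diagm (\<lambda>i. Xd' N i - Xd'' N i)) *v c)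
    + d \<bullet> ((matrix_inv (diagm (Tq'' N)) ** diagm (\<lambda>i. Xq' N i - Xq'' N i)) *v d)"
    unfolding 1[OF nz(1)] 1[OF nz(2)] 1[OF nz(3)] 1[OF nz(4)] 4
    by (simp only: y dissipation_def axis_dissipation_def prod.case power2_eq_square
        vector_add_component distrib_left sum.distrib add_ac)
  then show ?thesis
    unfolding y structure_map_unfold by (simp add: inner_diff_right inner_add_right 2 3)
qed

text \<open>With \<open>\<alpha> = (X\<^sub>d - X\<^sub>d') / T\<^sub>d'\<close> and \<open>\<beta> = (X\<^sub>d' - X\<^sub>d'') / T\<^sub>d''\<close>, the hypothesis on the
  time constants and reactances is \<open>4 * \<beta> > \<alpha>\<close>, and similarly for the other axis. Where the
  dissipation vanishes, only \<open>\<eta>\<close> and \<open>v\<close> can be nonzero, and \<open>v\<close> lies in the kernel of the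
  Laplacian; so only the momentum component of the image, \<open>- D \<eta> + Q\<^sup>-\<^sup>1 v\<close>, survives.\<close>

lemma dissipation_nonneg_null:
  assumes N: "network_ok N" and C: "controller_ok C"
    and d: "\<And>i. 4 * (Xd' N i - Xd'' N i) * Td' N i - (Xd N i - Xd' N i) * Td'' N i > 0"
    and q: "\<And>i. 4 * (Xq' N i - Xq'' N i) * Tq' N i - (Xq N i - Xq' N i) * Tq'' N i > 0"
  shows dissipation_nonneg: "dissipation N C y \<ge> 0"
    and dissipation_null: "dissipation N C y = 0 \<Longrightarrow>
      fst (fst y) = 0 \<and> (\<exists>u. structure_map N C y = ((u, 0, 0, 0, 0, 0), 0))"
proof -
  obtain p \<eta> a b c d v where y: "y = ((p, \<eta>, a, b, c, d), v)"
    by (metis surj_pair)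
  define \<alpha>d where "\<alpha>d i = (Xd N i - Xd' N i) / Td' N i" for i
  define \<beta>d where "\<beta>d i = (Xd' N i - Xd'' N i) / Td'' N i" for i
  define \<alpha>q where "\<alpha>q i = (Xq N i - Xq' N i) / Tq' N i" for i
  define \<beta>q where "\<beta>q i = (Xq' N i - Xq'' N i) / Tq'' N i" for i
  have T: "Td' N i > 0" "Tq' N i > 0" "Td'' N i > 0" "Tq'' N i > 0" "Xd N i > Xd' N i" "Xq N i > Xq' N i"
    and k: "gain C i > 0" for i
    using N C by (auto simp: network_ok_def controller_ok_def)
  have pos: "\<alpha>d i > 0" "4 * \<beta>d i > \<alpha>d i" "\<alpha>q i > 0" "4 * \<beta>q i > \<alpha>q i" for i
    using T[of i] d[of i] q[of i] by (auto simp: \<alpha>d_def \<beta>d_def \<alpha>q_def \<beta>q_def field_simps)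
  note ax = axis_dissipation_pos[OF pos(1,2)] axis_dissipation_pos[OF pos(3,4)]
  have w: "comm_weight C i k = comm_weight C k i" "comm_weight C i k \<ge> 0" for i k
    using C by (auto simp: controller_ok_def)
  define s where "s i = gain C i * (p $ i)\<^sup>2 + axis_dissipation (\<alpha>d i) (\<beta>d i) (a $ i) (c $ i)
    + axis_dissipation (\<alpha>q i) (\<beta>q i) (b $ i) (d $ i)" for i
  have s_nonneg: "s i \<ge> 0" for i
    unfolding s_def using k[of i] by (intro add_nonneg_nonneg ax) simp
  have L: "v \<bullet> (laplacian (comm_weight C) *v v) \<ge> 0" by (rule laplacian_psd[OF w])
  have eq: "dissipation N C y = (\<Sum>i\<in>UNIV. s i) + v \<bullet> (laplacian (comm_weight C) *v v)"
    by (simp add: y dissipation_def s_def \<alpha>d_def \<beta>d_def \<alpha>q_def \<beta>q_def)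
  show "dissipation N C y \<ge> 0"
    unfolding eq by (intro add_nonneg_nonneg sum_nonneg s_nonneg L)
  assume "dissipation N C y = 0"
  then have "(\<Sum>i\<in>UNIV. s i) = 0" and L0: "v \<bullet> (laplacian (comm_weight C) *v v) = 0"
    using L sum_nonneg[of UNIV s] s_nonneg unfolding eq by (auto simp: add_nonneg_eq_0_iff)
  then have "s i = 0" for i using s_nonneg by (simp add: sum_nonneg_eq_0_iff)
  then have "gain C i * (p $ i)\<^sup>2 = 0 \<and> axis_dissipation (\<alpha>d i) (\<beta>d i) (a $ i) (c $ i) = 0
      \<and> axis_dissipation (\<alpha>q i) (\<beta>q i) (b $ i) (d $ i) = 0" for i
    using ax(1)[of i "a $ i" "c $ i"] ax(3)[of i "b $ i" "d $ i"] k[of i]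
      mult_nonneg_nonneg[of "gain C i" "(p $ i)\<^sup>2"]
    unfolding s_def by (smt (verit) zero_le_power2)
  note null = this[THEN conjunct1] this[THEN conjunct2, THEN conjunct1, THEN ax(2)]
    this[THEN conjunct2, THEN conjunct2, THEN ax(4)]
  from null(1) have "p $ i = 0" for i
    using k[of i] by (metis less_irrefl mult_eq_0_iff power_eq_0_iff)
  with null(2,3) have z: "p = 0" "a = 0" "b = 0" "c = 0" "d = 0" by (simp_all add: vec_eq_iff)
  have "comm_weight C i k * (v $ i - v $ k) = 0" for i k
    using laplacian_null_edges[OF w L0, of i k] by auto
  then have "laplacian (comm_weight C) *v v = 0"
    by (simp only: vec_eq_iff laplacian_mult_vec sum.neutral_const zero_index simp_thms)
  then show "fst (fst y) = 0 \<and> (\<exists>u. structure_map N C y = ((u, 0, 0, 0, 0, 0), 0))"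
    by (simp add: y z structure_map_unfold)
qed

section \<open>Gradient of the Hamiltonian\<close>

lemma trig_expr_H_total:
  assumes "controller_ok C"
  shows "trig_expr (H_total N C)"
proof -
  have T: "time_const C i \<noteq> 0" for i
    using assms by (auto simp: controller_ok_def dest!: spec[of _ i])
  have coords: "trig_expr (\<lambda>x::'a state. fst (fst x) $ i)"
    "trig_expr (\<lambda>x::'a state. fst (snd (fst x)) $ l)"
    "trig_expr (\<lambda>x::'a state. fst (snd (snd (fst x))) $ i)"
    "trig_expr (\<lambda>x::'a state. fst (snd (snd (snd (fst x)))) $ i)"
    "trig_expr (\<lambda>x::'a state. fst (snd (snd (snd (snd (fst x))))) $ i)"
    "trig_expr (\<lambda>x::'a state. snd (snd (snd (snd (snd (fst x))))) $ i)"
    "trig_expr (\<lambda>x::'a state. snd x $ i)" for i l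
    by (rule trig_expr_linear, simp add: linear_iff)+
  have "H_total N C = (\<lambda>x. H_net N (fst x)
      + 1/2 * (\<Sum>i\<in>UNIV. snd x $ i * (snd x $ i / time_const C i)))"
    by (simp add: fun_eq_iff H_total_def inner_vec_def matrix_inv_diagm_mult_vec T split_beta)
  then show ?thesis
    unfolding H_net_def H_d_def H_q_def H_m_def H_edge_def split_beta
    by (auto intro!: trig_expr_intros coords)
qed

text \<open>Reads off a component of the gradient when the function is a quadratic polynomial along a
  line.\<close>

lemma GDERIV_from_quadratic_line:
  assumes G: "GDERIV f x :> d" and line: "\<And>t. f (x + t *\<^sub>R v) = f x + t * a + t\<^sup>2 * b"
  shows "v \<bullet> d = a"
proof -
  have "((\<lambda>t. x + t *\<^sub>R v) has_derivative (\<lambda>h. h *\<^sub>R v)) (at 0)"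
    by (auto intro!: derivative_eq_intros)
  then have "((\<lambda>t. f (x + t *\<^sub>R v)) has_derivative (\<lambda>h. (h *\<^sub>R v) \<bullet> d)) (at 0)"
    by (rule has_derivative_compose[where g = f, THEN has_derivative_eq_rhs])
       (use G in \<open>auto simp: gderiv_def\<close>)
  then have "DERIV (\<lambda>t. f x + t * a + t\<^sup>2 * b) 0 :> v \<bullet> d"
    unfolding line by (simp add: has_field_derivative_def mult_commute_abs)
  moreover have "DERIV (\<lambda>t. f x + t * a + t\<^sup>2 * b) 0 :> a"
    by (auto intro!: derivative_eq_intros)
  ultimately show ?thesis by (rule DERIV_unique)
qed

text \<open>Frequencies and controller variables enter the Hamiltonian as separate quadratic terms, so
  along lines in their directions it is a quadratic polynomial.\<close>

lemma gradient_H_total: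
  assumes "controller_ok C"
  shows "fst (fst (gradient (H_total N C) x)) = frequency N x"
    and "snd (gradient (H_total N C) x) = matrix_inv (diagm (time_const C)) *v snd x"
proof -
  note G = trig_expr_GDERIV[OF trig_expr_H_total[OF assms], of N x]
  obtain p \<eta> a b c d \<theta> where x: "x = ((p, \<eta>, a, b, c, d), \<theta>)" by (metis surj_pair)
  have T: "time_const C i \<noteq> 0" for i
    using assms by (auto simp: controller_ok_def dest!: spec[of _ i])
  have "w \<bullet> fst (fst (gradient (H_total N C) x)) = w \<bullet> frequency N x" for w
  proof -
    have m: "(\<Sum>i\<in>UNIV. H_m N (p + t *\<^sub>R w) i) = (\<Sum>i\<in>UNIV. H_m N p i)
        + t * (w \<bullet> frequency N x) + t\<^sup>2 * (\<Sum>i\<in>UNIV. H_m N w i)" for t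
      unfolding x H_m_def frequency_def inner_vec_def sum_distrib_left sum.distrib[symmetric]
      by (intro sum.cong refl) (simp add: power2_eq_square algebra_simps)
    have "((w, 0, 0, 0, 0, 0), 0) \<bullet> gradient (H_total N C) x = w \<bullet> frequency N x"
      by (rule GDERIV_from_quadratic_line[OF G, where b = "\<Sum>i\<in>UNIV. H_m N w i"])
         (simp add: x H_total_def H_net_def sum.distrib m[unfolded x])
    then show ?thesis by (simp add: inner_prod_def)
  qed
  then show "fst (fst (gradient (H_total N C) x)) = frequency N x"
    by (metis vector_eq_ldot)
  define Ti where "Ti = matrix_inv (diagm (time_const C))"
  have sym: "u \<bullet> (Ti *v w) = w \<bullet> (Ti *v u)" for u w
    by (simp add: Ti_def inner_vec_def matrix_inv_diagm_mult_vec T mult.commute)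
  have "w \<bullet> snd (gradient (H_total N C) x) = w \<bullet> (Ti *v \<theta>)" for w
  proof -
    have "(0, w) \<bullet> gradient (H_total N C) x = w \<bullet> (Ti *v \<theta>)"
      by (rule GDERIV_from_quadratic_line[OF G, where b = "1/2 * (w \<bullet> (Ti *v w))"])
         (simp add: x H_total_def Ti_def[symmetric] matrix_vector_right_distrib
           matrix_vector_mult_scaleR inner_add_left inner_add_right sym[of \<theta> w]
           power2_eq_square algebra_simps)
    then show ?thesis by (simp add: inner_prod_def)
  qed
  then show "snd (gradient (H_total N C) x) = matrix_inv (diagm (time_const C)) *v snd x"
    by (metis vector_eq_ldot Ti_def x snd_conv)
qed

section \<open>Optimality of the steady states\<close>

text \<open>With \<open>w = Q\<^sup>-\<^sup>1 1\<close>, the number \<open>1 \<bullet> Q\<^sup>-\<^sup>1 1\<close> is \<open>w \<bullet> Q w\<close>.\<close>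

lemma cost_inverse:
  assumes "controller_ok C"
  shows "transpose (matrix_inv (cost C)) = matrix_inv (cost C)"
    and "vec 1 \<bullet> (matrix_inv (cost C) *v vec 1) > 0"
proof -
  define Q where "Q = cost C"
  have sym: "transpose Q = Q" and pos: "x \<noteq> 0 \<Longrightarrow> x \<bullet> (Q *v x) > 0" for x
    using assms by (auto simp: controller_ok_def positive_definite_on_def Q_def)
  have "inj ((*v) Q)"
    using pos by (subst linear_injective_0) (fastforce simp: matrix_vector_mul_linear)+
  then have "invertible Q" by (simp add: invertible_left_inverse matrix_left_invertible_injective)
  note inv = invertible_matrix_inv[OF this]
  have "transpose (matrix_inv Q) ** Q = mat 1"
    using inv(1) sym by (metis matrix_transpose_mul transpose_mat)
  then show "transpose (matrix_inv (cost C)) = matrix_inv (cost C)"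
    unfolding Q_def[symmetric] using inv(1)
    by (metis matrix_mul_assoc matrix_mul_lid matrix_mul_rid)
  define w where "w = matrix_inv Q *v vec 1"
  have Qw: "Q *v w = vec 1" by (simp add: w_def matrix_vector_mul_assoc inv)
  then have "w \<noteq> 0" by (metis matrix_vector_mult_0_right vec_eq_iff vec_component zero_index zero_neq_one)
  from pos[OF this] show "vec 1 \<bullet> (matrix_inv (cost C) *v vec 1) > 0"
    unfolding Qw by (simp add: inner_commute w_def Q_def)
qed

lemma vec_constant:
  fixes x :: "real^'n"
  assumes "\<And>i k. x $ i = x $ k"
  shows "\<exists>s. x = s *\<^sub>R vec 1"
proof -
  fix k
  have "x = (x $ k) *\<^sub>R vec 1"
    using assms[of _ k] by (simp add: vec_eq_iff vec_def)
  then show ?thesis ..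
qed

text \<open>Balance of \<open>\<eta>\<close> forces a common frequency \<open>s\<close>. Summing the controller equation over the nodes
  kills the Laplacian and leaves \<open>s * (1 \<bullet> Q\<^sup>-\<^sup>1 1) = 0\<close>, so \<open>s = 0\<close>. Then the controller
  variables lie in the kernel of the Laplacian, hence equal a common value \<open>lam\<close>, and summing
  the momentum equation, in which the line flows cancel, identifies \<open>lam\<close> as \<open>\<lambda>\<^sup>*\<close>.\<close>

lemma steady_states_optimal:
  assumes N: "network_ok N" and C: "controller_ok C"
  shows "steady_states N C Pd \<subseteq> optimal_points N C Pd"
proof
  fix x assume "x \<in> steady_states N C Pd"
  then have xS: "x \<in> state_space N" and x0: "closed_loop N C Pd x = 0"
    by (auto simp: steady_states_def)
  define B where "B = matrix_inv (cost C)"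
  define \<sigma> where "\<sigma> = vec 1 \<bullet> (B *v (vec 1 :: real^'a))"
  have B: "transpose B = B" and \<sigma>: "\<sigma> > 0"
    using cost_inverse[OF C] by (simp_all add: B_def \<sigma>_def)
  have asym: "asym (edges N)" and conn: "connected_rel (edges N)" using N by (auto simp: network_ok_def)
  have w: "comm_weight C i k = comm_weight C k i" "comm_weight C i k \<ge> 0"
    and connC: "connected_rel {(i, k). comm_weight C i k > 0}" for i k
    using C by (auto simp: controller_ok_def)
  obtain p \<eta> a b c d v where z: "gradient (H_total N C) x = ((p, \<eta>, a, b, c, d), v)"
    by (metis surj_pair)
  have p: "frequency N x = p" and v: "matrix_inv (diagm (time_const C)) *v snd x = v"
    using gradient_H_total[OF C, of N x] by (simp_all add: z)
  have eqs: "- (incidence N *v \<eta>) - diagm (gain C) *v p + v v* B = Pd"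
    "p v* incidence N = 0" "laplacian (comm_weight C) *v v = - (B *v p)"
    using x0 unfolding closed_loop_eq z structure_map_unfold B_def[symmetric]
    by (auto simp: g_in_def zero_prod_def algebra_simps)

  have "p $ i = p $ k" if "(i, k) \<in> edges N" for i k
    using vec_mult_incidence[OF asym_no_loop[OF asym that], of p N] eqs(2) that by simp
  then have "p $ i = p $ k" for i k by (rule connected_rel_constant[OF conn])
  then obtain s where s: "p = s *\<^sub>R vec 1" using vec_constant by blast
  have "vec 1 \<bullet> (laplacian (comm_weight C) *v v) = 0" by (rule laplacian_column_sums[OF w(1)])
  then have "s * \<sigma> = 0" by (simp add: eqs(3) s matrix_vector_mult_scaleR \<sigma>_def)
  with \<sigma> s have p0: "p = 0" by simp
  then have "v \<bullet> (laplacian (comm_weight C) *v v) = 0" using eqs(3) by simp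
  note null = laplacian_null_edges[OF w this]
  have "v $ i = v $ k" for i k
  proof (rule connected_rel_constant[OF connC])
    show "v $ i = v $ k" if "(i, k) \<in> {(i, k). comm_weight C i k > 0}" for i k
      using null[of i k] that by fastforce
  qed
  then obtain lam where lam: "v = lam *\<^sub>R vec 1" using vec_constant by blast
  have "vec 1 \<bullet> Pd = - ((vec 1 v* incidence N) \<bullet> \<eta>) + vec 1 \<bullet> (transpose B *v v)"
    by (simp add: eqs(1)[symmetric] p0 inner_add_right inner_diff_right dot_lmul_matrix)
  also have "\<dots> = lam * \<sigma>"
    unfolding incidence_column_sums[OF asym] B lam
    by (simp add: matrix_vector_mult_scaleR \<sigma>_def)
  finally have lam_eq: "(vec 1 \<bullet> Pd) / \<sigma> = lam" using \<sigma> by simp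
  have "power_injection N C x = B *v (lam *\<^sub>R vec 1)"
    unfolding power_injection_def v p p0 lam B_def by simp
  then show "x \<in> optimal_points N C Pd"
    unfolding optimal_points_def Let_def mem_Collect_eq B_def[symmetric] \<sigma>_def[symmetric] lam_eq
    by (intro conjI xS p[unfolded p0])
qed

section \<open>Convergence to the set of optimal points\<close>

theorem theorem1:
  fixes N :: "'n::finite network" and C :: "'n controller"
    and Pd :: "real^'n" and xbar :: "'n state"
  assumes "network_ok N" and "controller_ok C"
    and "\<And>i. 4 * (Xd' N i - Xd'' N i) * Td' N i - (Xd N i - Xd' N i) * Td'' N i > 0"
    and "\<And>i. 4 * (Xq' N i - Xq'' N i) * Tq' N i - (Xq N i - Xq' N i) * Tq'' N i > 0"
    and "xbar \<in> steady_states N C Pd"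
    and "positive_definite_on (state_space N) (hessian (H_total N C) xbar)"
  shows "(\<exists>\<epsilon>>0. \<forall>x0\<in>state_space N \<inter> ball xbar \<epsilon>.
            (\<exists>x. trajectory N C Pd x \<and> x 0 = x0) \<and>
            (\<forall>x. trajectory N C Pd x \<and> x 0 = x0 \<longrightarrow>
                 ((\<lambda>t. infdist (x t) (steady_states N C Pd)) \<longlongrightarrow> 0) at_top))
         \<and> steady_states N C Pd \<subseteq> optimal_points N C Pd"
proof
  show "steady_states N C Pd \<subseteq> optimal_points N C Pd"
    by (rule steady_states_optimal[OF assms(1,2)])
next
  define S where "S = state_space N"
  define H where "H = H_total N C"
  define G where "G = gradient H"
  define F where "F = closed_loop N C Pd"
  define Z where "Z x = G x - G xbar" for x
  define V where "V x = H x - H xbar - G xbar \<bullet> (x - xbar)" for x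
  define W where "W x = dissipation N C (Z x)" for x
  have H: "trig_expr H" unfolding H_def by (rule trig_expr_H_total[OF assms(2)])
  have G: "GDERIV H x :> G x" for x unfolding G_def by (rule trig_expr_GDERIV[OF H])
  have G_trig: "trig_field G" unfolding G_def by (rule trig_expr_gradient[OF H])
  have S: "subspace S" "xbar \<in> S" "F x \<in> S" for x
    using assms(5) subspace_state_space[of N] closed_loop_in_state_space[of N C Pd x]
    by (auto simp: S_def F_def steady_states_def)
  have F_eq: "F x = structure_map N C (G x) - (g_in Pd, 0)" for x
    by (simp add: F_def G_def H_def closed_loop_eq)
  have "F xbar = 0" using assms(5) by (simp add: steady_states_def F_def)
  then have F_Z: "F x = structure_map N C (Z x)" for x
    using F_eq[of x] F_eq[of xbar] by (simp add: Z_def linear_diff[OF linear_structure_map])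
  have F_trig: "trig_field F"
    unfolding F_eq[abs_def] by (rule trig_field_linear_image[OF linear_structure_map G_trig])
  have V_grad: "GDERIV V x :> Z x" for x
  proof -
    have "GDERIV (\<lambda>x. H x - (x \<bullet> G xbar + (H xbar - xbar \<bullet> G xbar))) x :> G x - (G xbar + 0)"
      by (intro GDERIV_diff G GDERIV_add GDERIV_const) (auto simp: gderiv_def intro!: derivative_eq_intros)
    moreover have "V = (\<lambda>x. H x - (x \<bullet> G xbar + (H xbar - xbar \<bullet> G xbar)))"
      by (auto simp: V_def inner_diff_right inner_commute)
    ultimately show ?thesis by (simp add: Z_def)
  qed
  have diss: "Z x \<bullet> F x = - W x" for x
    unfolding F_Z W_def by (rule inner_structure_map[OF assms(1)])
  note null = dissipation_nonneg_null[OF assms(1-4)]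
  have W_nonneg: "W x \<ge> 0" for x unfolding W_def by (rule null(1))
  \<comment> \<open>By the dissipation identity, W inherits continuity from Z and F.\<close>
  have W_cont: "continuous_on K W" for K
  proof -
    have "continuous_on K (\<lambda>x. - (Z x \<bullet> F x))"
      unfolding Z_def by (intro continuous_intros trig_field_continuous G_trig F_trig)
    then show ?thesis by (simp add: diss)
  qed

  have "(G has_derivative hessian H xbar) (at xbar)"
    using trig_field_differentiable[OF G_trig] unfolding hessian_def G_def
    by (simp add: frechet_derivative_works)
  with assms(6) obtain c r where c: "c > 0" and r: "r > 0"
    and growth: "\<And>y. y \<in> S \<inter> cball xbar r \<Longrightarrow> c * (dist xbar y)\<^sup>2 \<le> V y"
    unfolding V_def using positive_definite_hessian_quadratic_growth[OF S(1,2) G] by (metis H_def S_def)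
  obtain L where "L-lipschitz_on (cball xbar r) F"
    using trig_field_lipschitz_on_cball[OF F_trig] by blast
  from lyapunov_stability[OF S(1,3,2) this r V_grad _ _ c growth]
  obtain \<epsilon> where \<epsilon>: "\<epsilon> > 0"
    and exist: "\<And>x0. x0 \<in> S \<inter> ball xbar \<epsilon> \<Longrightarrow> \<exists>x. x 0 = x0 \<and>
       (\<forall>t\<ge>0. x t \<in> S \<and> (x has_vector_derivative F (x t)) (at t within {0..}))"
    and stay: "\<And>x t. \<lbrakk>x 0 \<in> S \<inter> ball xbar \<epsilon>;
       \<And>t. t \<ge> 0 \<Longrightarrow> (x has_vector_derivative F (x t)) (at t within {0..}); t \<ge> 0\<rbrakk>
       \<Longrightarrow> x t \<in> S \<inter> cball xbar r"
    using W_nonneg by (auto simp: diss V_def)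
  define K where "K = S \<inter> cball xbar r"
  have K: "compact K" "xbar \<in> K"
    using S r by (auto simp: K_def intro: closed_Int_compact closed_subspace)
  have converge: "((\<lambda>t. infdist (x t) (steady_states N C Pd)) \<longlongrightarrow> 0) at_top"
    if x: "x 0 \<in> S \<inter> ball xbar \<epsilon>"
      "\<And>t. t \<ge> 0 \<Longrightarrow> (x has_vector_derivative F (x t)) (at t within {0..})" for x
  \<comment> \<open>P selects the momenta: they are proportional to the frequencies, hence frozen where W
    vanishes, and their velocities are the only ones that W does not control.\<close>
  proof (rule lyapunov_barbalat_convergence[where P = "\<lambda>x. fst (fst x)" and K = K and z = xbar
        and F = F and V = V and W = W and Z = Z])
    show "x t \<in> K" if "t \<ge> 0" for t
      unfolding K_def by (rule stay[OF x that])
    show "continuous_on K F" by (rule trig_field_continuous[OF F_trig])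
    show "bounded_linear (\<lambda>x::'n state. fst (fst x))"
      by (simp add: linear_conv_bounded_linear[symmetric] linear_iff)
    fix y assume y: "y \<in> K" "W y = 0"
    from null(2)[OF y(2)[unfolded W_def]]
    have Zp: "fst (fst (Z y)) = 0" and Fy: "\<exists>u. F y = ((u, 0, 0, 0, 0, 0), 0)"
      by (auto simp: F_Z)
    from Zp have "frequency N y = frequency N xbar"
      using gradient_H_total(1)[OF assms(2), of N] by (simp add: Z_def G_def H_def)
    then have "inverse (inertia N i) * fst (fst y) $ i = inverse (inertia N i) * fst (fst xbar) $ i" for i
      by (simp add: frequency_def split_beta vec_eq_iff)
    moreover have "inertia N i > 0" for i using assms(1) by (auto simp: network_ok_def)
    ultimately show "fst (fst y) = fst (fst xbar)"
      by (metis inverse_nonzero_iff_nonzero less_irrefl mult_left_cancel vec_eq_iff)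
    show "y \<in> steady_states N C Pd" if "fst (fst (F y)) = 0"
    proof -
      have "F y = 0" using Fy that by (auto simp: zero_prod_def)
      then show ?thesis using y(1) by (auto simp: steady_states_def F_def K_def S_def)
    qed
  qed (use K x V_grad diss W_nonneg W_cont in auto)
  show "\<exists>\<epsilon>>0. \<forall>x0\<in>state_space N \<inter> ball xbar \<epsilon>.
            (\<exists>x. trajectory N C Pd x \<and> x 0 = x0) \<and>
            (\<forall>x. trajectory N C Pd x \<and> x 0 = x0 \<longrightarrow>
                 ((\<lambda>t. infdist (x t) (steady_states N C Pd)) \<longlongrightarrow> 0) at_top)"
  proof (intro exI[of _ \<epsilon>] conjI ballI allI impI)
    fix x0 assume x0: "x0 \<in> state_space N \<inter> ball xbar \<epsilon>"
    then show "\<exists>x. trajectory N C Pd x \<and> x 0 = x0"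
      using exist[of x0] unfolding trajectory_def S_def F_def by blast
    fix x assume "trajectory N C Pd x \<and> x 0 = x0"
    then show "((\<lambda>t. infdist (x t) (steady_states N C Pd)) \<longlongrightarrow> 0) at_top"
      using x0 by (intro converge) (auto simp: trajectory_def S_def F_def)
  qed (rule \<epsilon>)
qed

end
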